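(* For $q\geq 4$ even, planes in $\mathrm{PG}(5,q)$ with point-orbit distribution $[0,q+1,0,q^2]$ form a unique $K$-orbit, namely $\Sigma_{16}$, with hyperplane-orbit distribution $[q+1,0,0,q^2]$.
   Context: Points of $\mathrm{PG}(5,q)$ are identified with symmetric $3\times3$ matrices over $\mathbb{F}_q$ up to scalars; rank of a point is the rank of its matrix. $K\cong\mathrm{PGL}(3,q)$ acts by $M\mapsto AMA^T$. For $q$ even, the point-orbit distribution of a subspace $W$ is $[r_1,r_{2,n},r_{2,s},r_3]$, where $r_1,r_3$ count points of rank 1 and 3 in $W$, $r_{2,n}$ counts rank-2 points in $W\cap\pi_{\mathcal{N}}$ and $r_{2,s}$ rank-2 points of $W$ outside $\pi_{\mathcal{N}}$; here $\pi_{\mathcal{N}}=\mathcal{Z}(Y_0,Y_3,Y_5)$ is the nucleus plane (zero-diagonal matrices). Hyperplanes $\mathcal{Z}(\sum a_{ij}Y)$ correspond to conics $\mathcal{Z}(\sum_{i\le j}a_{ij}X_iX_j)$ of $\mathrm{PG}(2,q)$, giving four $K$-orbits $\mathcal{H}_1,\mathcal{H}_{2,r},\mathcal{H}_{2,i},\mathcal{H}_3$ (double lines, pairs of real lines, pairs of conjugate imaginary lines, non-singular conics); the hyperplane-orbit distribution of $W$ is $[h_1,h_{2,r},h_{2,i},h_3]$, counting hyperplanes of each orbit containing $W$. $\Sigma_{16}$ is the name given to the resulting orbit. *)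

theory Defs
  imports "HOL-Analysis.Analysis" "HOL-Algebra.Algebraic_Closure_Type"
begin

text \<open>
  The field with \<open>q\<close> elements is a type \<open>'a :: {field, finite}\<close> with \<open>q = CARD('a)\<close>.
  Index type \<open>3\<close> has the elements \<open>0 < 1 < 2\<close> (the numeral \<open>3\<close> denotes \<open>0\<close>), so
  subscripts agree with the usual \<open>X\<^sub>0, X\<^sub>1, X\<^sub>2\<close>.
\<close>

definition mscale :: "'a::field \<Rightarrow> 'a^3^3 \<Rightarrow> 'a^3^3" where
  "mscale c M = (\<chi> i j. c * M $ i $ j)"

global_interpretation msp: vector_space "mscale :: 'a::field \<Rightarrow> 'a^3^3 \<Rightarrow> 'a^3^3"
  by unfold_locales (simp_all add: mscale_def vec_eq_iff algebra_simps)

definition sym_mats :: "('a::field^3^3) set" where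
  "sym_mats = {M. transpose M = M}"

text \<open>Subspaces of \<open>PG(5,q)\<close> of projective dimension \<open>d\<close>, as linear subspaces of
  the six-dimensional space of symmetric matrices.\<close>

definition PG5 :: "nat \<Rightarrow> ('a::field^3^3) set set" where
  "PG5 d = {W. msp.subspace W \<and> W \<subseteq> sym_mats \<and> msp.dim W = d + 1}"

abbreviation planes :: "('a::field^3^3) set set" where
  "planes \<equiv> PG5 2"

text \<open>A nonzero scalar matrix acts trivially on subspaces, so the orbits of
  \<open>GL(3,q)\<close> below are those of \<open>K = PGL(3,q)\<close>.\<close>

definition K_act :: "'a::field^3^3 \<Rightarrow> ('a^3^3) set \<Rightarrow> ('a^3^3) set" where
  "K_act A W = (\<lambda>M. A ** M ** transpose A) ` W"

definition K_orbit :: "('a::field^3^3) set \<Rightarrow> ('a^3^3) set set" where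
  "K_orbit W = {K_act A W | A. invertible A}"

definition plane_orbits :: "('a::field^3^3) set set set" where
  "plane_orbits = K_orbit ` planes"

definition points_of_rank :: "nat \<Rightarrow> ('a::field^3^3) set set" where
  "points_of_rank k = {P \<in> PG5 0. \<forall>M \<in> P - {0}. rank M = k}"

definition nucleus_plane :: "('a::field^3^3) set" where
  "nucleus_plane = {M \<in> sym_mats. \<forall>i. M $ i $ i = 0}"

definition point_orbit_distribution :: "('a::field^3^3) set \<Rightarrow> nat list" where
  "point_orbit_distribution W =
    [card {P \<in> points_of_rank 1. P \<subseteq> W},
     card {P \<in> points_of_rank 2. P \<subseteq> W \<and> P \<subseteq> nucleus_plane},
     card {P \<in> points_of_rank 2. P \<subseteq> W \<and> \<not> P \<subseteq> nucleus_plane},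
     card {P \<in> points_of_rank 3. P \<subseteq> W}]"

text \<open>A ternary quadratic form \<open>\<Sum>\<^bsub>i\<le>j\<^esub> a\<^sub>i\<^sub>j X\<^sub>i X\<^sub>j\<close> is given by the
  upper triangular matrix of its coefficients.\<close>

definition conic_coeffs :: "('a::field^3^3) set" where
  "conic_coeffs = {a. a \<noteq> 0 \<and> (\<forall>i j. j < i \<longrightarrow> a $ i $ j = 0)}"

definition qform :: "'a::field^3^3 \<Rightarrow> 'a^3 \<Rightarrow> 'a" where
  "qform a x = (\<Sum>i\<in>UNIV. \<Sum>j\<in>{i..}. a $ i $ j * x $ i * x $ j)"

definition qform_partial :: "'a::field^3^3 \<Rightarrow> 3 \<Rightarrow> 'a^3 \<Rightarrow> 'a" where
  "qform_partial a k x = (\<Sum>i\<in>UNIV. \<Sum>j\<in>{i..}.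
     a $ i $ j * ((if i = k then x $ j else 0) + (if j = k then x $ i else 0)))"

definition lform :: "'a::field^3 \<Rightarrow> 'a^3 \<Rightarrow> 'a" where
  "lform l x = (\<Sum>i\<in>UNIV. l $ i * x $ i)"

definition ac_vec :: "'a::field^3 \<Rightarrow> 'a alg_closure^3" where
  "ac_vec l = (\<chi> i. to_ac (l $ i))"

definition ac_mat :: "'a::field^3^3 \<Rightarrow> 'a alg_closure^3^3" where
  "ac_mat a = (\<chi> i j. to_ac (a $ i $ j))"

text \<open>Identities between forms are required at all points over the algebraic closure;
  that field is infinite, so they are identities of polynomials. (Over the finite field
  itself, functions do not determine polynomials.)\<close>

definition double_line :: "'a::field^3^3 \<Rightarrow> bool" where
  "double_line a \<longleftrightarrow> (\<exists>c l. c \<noteq> 0 \<and> l \<noteq> 0 \<and>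
     (\<forall>x. qform (ac_mat a) x = to_ac c * (lform (ac_vec l) x)\<^sup>2))"

definition real_line_pair :: "'a::field^3^3 \<Rightarrow> bool" where
  "real_line_pair a \<longleftrightarrow> (\<exists>l m. l \<noteq> 0 \<and> m \<noteq> 0 \<and> (\<nexists>c. m = c *s l) \<and>
     (\<forall>x. qform (ac_mat a) x = lform (ac_vec l) x * lform (ac_vec m) x))"

text \<open>The subfield of order \<open>q\<^sup>2\<close> of the closure is the set of roots of \<open>X^(q\<^sup>2) = X\<close>,
  and conjugation over the base field is \<open>x \<mapsto> x^q\<close>; a line over that
  subfield is imaginary iff it differs from its conjugate.\<close>

definition conj_vec :: "('a::{field,finite}) alg_closure^3 \<Rightarrow> 'a alg_closure^3" where
  "conj_vec l = (\<chi> i. (l $ i) ^ CARD('a))"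

definition imaginary_line_pair :: "'a::{field,finite}^3^3 \<Rightarrow> bool" where
  "imaginary_line_pair a \<longleftrightarrow> (\<exists>c (l :: 'a alg_closure^3). c \<noteq> 0 \<and> l \<noteq> 0 \<and>
     (\<forall>i. (l $ i) ^ (CARD('a)\<^sup>2) = l $ i) \<and> (\<nexists>d. conj_vec l = d *s l) \<and>
     (\<forall>x. qform (ac_mat a) x = to_ac c * (lform l x * lform (conj_vec l) x)))"

definition nonsingular_conic :: "'a::field^3^3 \<Rightarrow> bool" where
  "nonsingular_conic a \<longleftrightarrow>
     \<not> (\<exists>x. x \<noteq> 0 \<and> qform (ac_mat a) x = 0 \<and> (\<forall>k. qform_partial (ac_mat a) k x = 0))"

text \<open>The hyperplane of a conic is \<open>\<Sum>\<^bsub>i\<le>j\<^esub> a\<^sub>i\<^sub>j Y\<^sub>i\<^sub>j = 0\<close>, where the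
  \<open>Y\<^sub>i\<^sub>j\<close> with \<open>i \<le> j\<close> are the six entries of a symmetric matrix on and above the diagonal
  (no factor 2 off the diagonal).\<close>

definition hyperplane_of :: "'a::field^3^3 \<Rightarrow> ('a^3^3) set" where
  "hyperplane_of a = {M \<in> sym_mats. (\<Sum>i\<in>UNIV. \<Sum>j\<in>{i..}. a $ i $ j * M $ i $ j) = 0}"

definition H1 :: "('a::field^3^3) set set" where
  "H1 = {hyperplane_of a | a. a \<in> conic_coeffs \<and> double_line a}"

definition H2r :: "('a::field^3^3) set set" where
  "H2r = {hyperplane_of a | a. a \<in> conic_coeffs \<and> real_line_pair a}"

definition H2i :: "('a::{field,finite}^3^3) set set" where
  "H2i = {hyperplane_of a | a. a \<in> conic_coeffs \<and> imaginary_line_pair a}"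

definition H3 :: "('a::field^3^3) set set" where
  "H3 = {hyperplane_of a | a. a \<in> conic_coeffs \<and> nonsingular_conic a}"

definition hyperplane_orbit_distribution :: "('a::{field,finite}^3^3) set \<Rightarrow> nat list" where
  "hyperplane_orbit_distribution W =
    [card {H \<in> H1. W \<subseteq> H}, card {H \<in> H2r. W \<subseteq> H},
     card {H \<in> H2i. W \<subseteq> H}, card {H \<in> H3. W \<subseteq> H}]"

end

theory Submission
  imports Defs
begin

text \<open>
  A plane \<open>W\<close> has point-orbit distribution \<open>[0, q + 1, 0, q\<^sup>2]\<close> iff it meets the nucleus plane in a
  line and all its other points are non-singular. For \<open>q\<close> even, the determinant of a symmetric
  matrix \<open>M\<close> is the square of an affine function of the off-diagonal entries, with linear part
  given by the square roots \<open>v\<close> of the diagonal of \<open>M\<close>. If \<open>M \<in> W\<close> is not in the nucleus plane, this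
  linear part must therefore vanish on the nucleus line of \<open>W\<close>, hence determines that line.
  A congruence \<open>M \<mapsto> A M A\<^sup>T\<close> maps \<open>v\<close> to \<open>A v\<close>, so one may take \<open>v = (0, 0, 1)\<close>, and a diagonal
  congruence then brings \<open>W\<close> to the form \<open>y\<^sub>0\<^sub>0 = y\<^sub>1\<^sub>1 = 0\<close>, \<open>y\<^sub>0\<^sub>1 = y\<^sub>2\<^sub>2\<close>.

  The hyperplanes through this plane belong to the conics \<open>s X\<^sub>0\<^sup>2 + t X\<^sub>1\<^sup>2 + u (X\<^sub>0X\<^sub>1 + X\<^sub>2\<^sup>2)\<close>.
  For \<open>u = 0\<close> these are double lines, as every element of the field is a square, and for \<open>u \<noteq> 0\<close>
  they are non-singular.
\<close>

no_notation fps_nth (infixl \<open>$\<close> 75)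

section \<open>Symmetric 3 x 3 matrices: determinant and rank, in particular in characteristic
  2\<close>

lemma three_eq_zero: "(3::3) = 0" by simp

text \<open>Library facts enumerate the type \<open>3\<close> as 1, 2, 3; reading the numeral
  \<open>3\<close> as \<open>0\<close> turns them into facts about the indices 0, 1, 2.\<close>

lemma UNIV3: "(UNIV :: 3 set) = {0, 1, 2}"
  using UNIV_3 by (auto simp: three_eq_zero)

lemma sum_UNIV3: "sum f (UNIV :: 3 set) = f 0 + f 1 + (f 2 :: 'b::comm_monoid_add)"
  unfolding UNIV3 by (simp add: add.assoc)

lemma all3: "(\<forall>i::3. P i) \<longleftrightarrow> P 0 \<and> P 1 \<and> P 2"
  by (metis UNIV3 UNIV_I empty_iff insert_iff)

lemma less3 [simp]:
  "(0::3) < 1" "(0::3) < 2" "(1::3) < 2" "\<not> (1::3) < 0" "\<not> (2::3) < 0" "\<not> (2::3) < 1"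
  by (simp_all add: less_bit1_def bit1.Rep_0 bit1.Rep_1 bit1.Rep_numeral)

lemma atLeast3:
  "{0::3..} = {0, 1, 2}" "{1::3..} = {1, 2}" "{2::3..} = {2}"
proof -
  have "x \<in> {0::3, 1, 2}" for x using UNIV3 by blast
  then show "{0::3..} = {0, 1, 2}" "{1::3..} = {1, 2}" "{2::3..} = {2}"
    by (auto simp: not_less[symmetric]; metis less3 insert_iff empty_iff)+
qed

lemma det3:
  "det (A :: 'a::comm_ring_1^3^3) =
    A$0$0 * A$1$1 * A$2$2 + A$0$1 * A$1$2 * A$2$0 + A$0$2 * A$1$0 * A$2$1
    - A$0$0 * A$1$2 * A$2$1 - A$0$1 * A$1$0 * A$2$2 - A$0$2 * A$1$1 * A$2$0"
  unfolding det_3 by (simp only: three_eq_zero) (simp add: mult.assoc mult.commute mult.left_commute)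

text \<open>Rank is the dimension of the row space, so full rank means that the rows span, which is
  left invertibility.\<close>

lemma rank_eq_3_iff: "rank (A :: 'a::field^3^3) = 3 \<longleftrightarrow> det A \<noteq> 0"
proof -
  have "rank A = 3 \<longleftrightarrow> vec.dim (rows A) = vec.dim (UNIV :: ('a^3) set)"
    by (simp add: row_rank_def_gen vec_dim_card card_cart_basis)
  also have "\<dots> \<longleftrightarrow> vec.span (rows A) = UNIV"
    using vec.dim_eq_span[of "rows A" UNIV] vec.dim_span[of "rows A"] vec.span_UNIV
    by (metis order_refl subset_UNIV)
  also have "\<dots> \<longleftrightarrow> (\<exists>B. B ** A = mat 1)"
    using matrix_left_invertible_span_rows_gen by blast
  finally show ?thesis
    using invertible_det_nz[of A] invertible_left_inverse[of A] by blast
qed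

lemma rank_le_3: "rank (A :: 'a::field^3^3) \<le> 3"
  using vec.dim_subset[of "rows A" UNIV] by (simp add: row_rank_def_gen vec_dim_card card_cart_basis)

lemma rank_eq_0_iff: "rank (A :: 'a::field^3^3) = 0 \<longleftrightarrow> A = 0"
proof -
  have "rank A = 0 \<longleftrightarrow> (\<forall>i. row i A = 0)"
    by (auto simp: row_rank_def_gen rows_def)
  then show ?thesis by (simp add: row_def vec_eq_iff)
qed

lemma rank_ge_2:
  fixes A :: "'a::field^3^3"
  assumes "row i A \<noteq> 0" "\<And>c. row j A \<noteq> c *s row i A"
  shows "2 \<le> rank A"
proof -
  have "row j A \<notin> vec.span {row i A}"
    using assms(2) by (auto simp: vec.span_singleton)
  moreover have "vec.independent {row i A}" using assms(1) by simp
  ultimately have "vec.independent {row j A, row i A}"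
    by (simp add: vec.independent_insert)
  moreover have "row j A \<noteq> row i A" using assms(2)[of 1] by auto
  moreover have "{row j A, row i A} \<subseteq> rows A" by (auto simp: rows_def)
  ultimately show ?thesis
    unfolding row_rank_def_gen
    by (metis (no_types, lifting) card_2_iff vec.independent_card_le_dim)
qed

lemma rank_mscale:
  assumes "c \<noteq> 0" shows "rank (mscale c A) = rank A"
proof -
  have sub: "rows (mscale c A) \<subseteq> vec.span (rows A)" for c and A :: "'a^3^3"
  proof
    fix r assume "r \<in> rows (mscale c A)"
    then obtain i where "r = c *s row i A" by (auto simp: rows_def row_def mscale_def vec_eq_iff)
    then show "r \<in> vec.span (rows A)"
      using vec.span_scale[OF vec.span_base[of "row i A" "rows A"]] by (auto simp: rows_def)
  qed
  have "rank (mscale c A) \<le> rank A" for c and A :: "'a^3^3"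
    unfolding row_rank_def_gen using vec.dim_mono[OF sub[of c A]] by simp
  \<comment> \<open>The inequality holds for every scalar; \<open>c\<close> and its inverse give the
    two directions.\<close>
  from this[of c A] this[of "inverse c" "mscale c A"] assms show ?thesis by simp
qed

text \<open>The diagonal comes first; \<open>d\<close>, \<open>e\<close>, \<open>f\<close> are then
  listed by the index missing from their position, so that in characteristic 2 the determinant reads
  \<open>a*b*c + a*d^2 + b*e^2 + c*f^2\<close>.\<close>

definition smat :: "'a \<Rightarrow> 'a \<Rightarrow> 'a \<Rightarrow> 'a \<Rightarrow> 'a \<Rightarrow> 'a \<Rightarrow> 'a^3^3" where
  "smat a b c d e f = (\<chi> i j. if i = j then (if i = 0 then a else if i = 1 then b else c)
     else if i \<noteq> 0 \<and> j \<noteq> 0 then d else if i \<noteq> 1 \<and> j \<noteq> 1 then e else f)"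

lemma smat_nth [simp]:
  "smat a b c d e f $ 0 $ 0 = a" "smat a b c d e f $ 1 $ 1 = b" "smat a b c d e f $ 2 $ 2 = c"
  "smat a b c d e f $ 1 $ 2 = d" "smat a b c d e f $ 2 $ 1 = d"
  "smat a b c d e f $ 0 $ 2 = e" "smat a b c d e f $ 2 $ 0 = e"
  "smat a b c d e f $ 0 $ 1 = f" "smat a b c d e f $ 1 $ 0 = f"
  by (simp_all add: smat_def)

lemma sym_mats_iff:
  "M \<in> sym_mats \<longleftrightarrow> M$1$0 = M$0$1 \<and> M$2$0 = M$0$2 \<and> M$2$1 = M$1$2"
  by (auto simp: sym_mats_def transpose_def vec_eq_iff all3)

lemma smat_in_sym_mats [simp]: "smat a b c d e f \<in> sym_mats"
  by (simp add: sym_mats_iff)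

lemma sym_mats_eq_smat:
  "M \<in> sym_mats \<Longrightarrow> M = smat (M$0$0) (M$1$1) (M$2$2) (M$1$2) (M$0$2) (M$0$1)"
  by (simp add: sym_mats_iff vec_eq_iff all3)

lemma smat_eq_iff:
  "smat a b c d e f = smat a' b' c' d' e' f' \<longleftrightarrow>
     a = a' \<and> b = b' \<and> c = c' \<and> d = d' \<and> e = e' \<and> f = f'"
  by (metis smat_nth)

lemma mscale_smat [simp]:
  "mscale t (smat a b c d e f) = smat (t*a) (t*b) (t*c) (t*d) (t*e) (t*f)"
  by (simp add: mscale_def vec_eq_iff all3)

lemma smat_add [simp]:
  "smat a b c d e f + smat a' b' c' d' e' f' = smat (a+a') (b+b') (c+c') (d+d') (e+e') (f+f')"
  by (simp add: vec_eq_iff all3)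

lemma smat_zero: "smat 0 0 0 0 0 0 = 0"
  by (simp add: vec_eq_iff all3)

lemma mem_nucleus_plane_iff:
  "M \<in> nucleus_plane \<longleftrightarrow> M \<in> sym_mats \<and> M$0$0 = 0 \<and> M$1$1 = 0 \<and> M$2$2 = 0"
  by (simp add: nucleus_plane_def all3)

lemma smat_in_nucleus_plane [simp]:
  "smat a b c d e f \<in> nucleus_plane \<longleftrightarrow> a = 0 \<and> b = 0 \<and> c = 0"
  by (simp add: mem_nucleus_plane_iff)

text \<open>The two products along 3-cycles coincide for symmetric matrices and cancel, and signs
  disappear.\<close>

lemma det_sym_char2:
  fixes M :: "'a::field^3^3"
  assumes "(2::'a) = 0" "M \<in> sym_mats"
  shows "det M = M$0$0 * M$1$1 * M$2$2 + M$0$0 * (M$1$2)\<^sup>2 + M$1$1 * (M$0$2)\<^sup>2 + M$2$2 * (M$0$1)\<^sup>2"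
proof -
  have "det M = M$0$0 * M$1$1 * M$2$2 + M$0$0 * (M$1$2)\<^sup>2 + M$1$1 * (M$0$2)\<^sup>2 + M$2$2 * (M$0$1)\<^sup>2
    + 2 * (M$1$2 * M$0$2 * M$0$1 - M$0$0 * (M$1$2)\<^sup>2 - M$1$1 * (M$0$2)\<^sup>2 - M$2$2 * (M$0$1)\<^sup>2)"
    using assms(2) by (simp add: det3 sym_mats_iff power2_eq_square algebra_simps)
  then show ?thesis by (simp add: assms(1))
qed

text \<open>In characteristic 2 these matrices are alternating, hence of even rank: the determinant
  formula gives 0, and any nonzero entry exhibits two independent rows.\<close>

lemma rank_nucleus:
  fixes M :: "'a::field^3^3"
  assumes char2: "(2::'a) = 0" and M: "M \<in> nucleus_plane" "M \<noteq> 0"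
  shows "rank M = 2"
proof -
  define d e f where "d = M$1$2" "e = M$0$2" "f = M$0$1"
  have Meq: "M = smat 0 0 0 d e f"
    using M sym_mats_eq_smat[of M] by (simp add: mem_nucleus_plane_iff d_e_f_def)
  have "d \<noteq> 0 \<or> e \<noteq> 0 \<or> f \<noteq> 0" using M(2) Meq smat_zero by auto
  then have "2 \<le> rank M"
  proof (elim disjE)
    assume "d \<noteq> 0"
    then show ?thesis by (intro rank_ge_2[of 1 _ 2]) (auto simp: Meq row_def vec_eq_iff all3)
  next
    assume "e \<noteq> 0"
    then show ?thesis by (intro rank_ge_2[of 0 _ 2]) (auto simp: Meq row_def vec_eq_iff all3)
  next
    assume "f \<noteq> 0"
    then show ?thesis by (intro rank_ge_2[of 0 _ 1]) (auto simp: Meq row_def vec_eq_iff all3)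
  qed
  moreover have "det M = 0"
    using det_sym_char2[OF char2, of M] by (simp add: Meq)
  then have "rank M \<noteq> 3" by (simp add: rank_eq_3_iff)
  ultimately show ?thesis using rank_le_3[of M] by simp
qed

section \<open>Finite fields of even order, and counting in projective spaces\<close>

lemma even_card_imp_char2:
  assumes "even CARD('a::{field,finite})"
  shows "(2::'a) = 0"
proof (rule ccontr)
  assume two: "(2::'a) \<noteq> 0"
  have "even (card (UNIV - {0::'a}))"
  proof -
    \<comment> \<open>If 2 is nonzero, negation has no nonzero fixed point, so the sets
      \<open>{x, -x}\<close> partition the nonzero elements into pairs.\<close>
    have ne: "x \<noteq> - x" if "x \<noteq> 0" for x :: 'a
      using that two by (metis add.right_inverse mult_2 mult_eq_0_iff)
    have "2 * card ((\<lambda>x. {x, -x}) ` (UNIV - {0::'a})) = card (\<Union> ((\<lambda>x. {x, -x}) ` (UNIV - {0::'a})))"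
      by (rule card_partition) (auto simp: card_2_iff doubleton_eq_iff dest: ne)
    also have "\<Union> ((\<lambda>x. {x, -x}) ` (UNIV - {0::'a})) = UNIV - {0}" by auto
    finally show ?thesis by (metis dvd_triv_left)
  qed
  moreover have "card (UNIV - {0::'a}) = CARD('a) - 1" by (simp add: card_Diff_singleton)
  ultimately have "even (CARD('a) - 1)" by presburger
  moreover have "CARD('a) = Suc (CARD('a) - 1)" by simp
  ultimately show False using assms by (metis even_Suc)
qed

text \<open>Squaring is additive in characteristic 2, hence injective, hence surjective on a finite
  field.\<close>

lemma char2_sqrt:
  fixes x :: "'a::{field,finite}"
  assumes "(2::'a) = 0"
  obtains y where "y\<^sup>2 = x"
proof -
  have "inj (\<lambda>y::'a. y\<^sup>2)"
  proof (rule injI)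
    fix y z :: 'a assume "y\<^sup>2 = z\<^sup>2"
    moreover have "(y - z)\<^sup>2 = y\<^sup>2 - z\<^sup>2 - 2 * z * (y - z)" by (simp add: power2_eq_square algebra_simps)
    ultimately show "y = z" using assms by simp
  qed
  then have "surj (\<lambda>y::'a. y\<^sup>2)" by (simp add: finite_UNIV_inj_surj)
  then show ?thesis using that by (metis surjD)
qed

text \<open>Coordinates with respect to a basis \<open>B\<close> give a bijection with the functions
  from \<open>B\<close> to the field, taken extensional so that they are determined by their values
  on \<open>B\<close>.\<close>

lemma card_subspace:
  fixes W :: "('a::{field,finite}^3^3) set"
  assumes "msp.subspace W"
  shows "card W = CARD('a) ^ msp.dim W"
proof -
  obtain B where B: "B \<subseteq> W" "msp.independent B" "W \<subseteq> msp.span B" "card B = msp.dim W"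
    using msp.basis_exists by blast
  have W: "W = msp.span B" using B assms by (simp add: msp.span_minimal subset_antisym)
  have fin: "finite B" by simp
  have "bij_betw (\<lambda>u. \<Sum>v\<in>B. mscale (u v) v) (B \<rightarrow>\<^sub>E UNIV) W"
  proof (rule bij_betwI')
    fix u w assume uw: "u \<in> B \<rightarrow>\<^sub>E (UNIV::'a set)" "w \<in> B \<rightarrow>\<^sub>E (UNIV::'a set)"
    show "((\<Sum>v\<in>B. mscale (u v) v) = (\<Sum>v\<in>B. mscale (w v) v)) = (u = w)"
    proof
      assume "(\<Sum>v\<in>B. mscale (u v) v) = (\<Sum>v\<in>B. mscale (w v) v)"
      then have "(\<Sum>v\<in>B. mscale (u v - w v) v) = 0"
        by (simp add: msp.scale_left_diff_distrib sum_subtractf)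
      then have "u v - w v = 0" if "v \<in> B" for v
        using msp.independentD[OF B(2) fin subset_refl, of "\<lambda>v. u v - w v" v] that by simp
      then show "u = w" using uw by (intro PiE_ext) auto
    qed simp
  next
    fix u :: "'a^3^3 \<Rightarrow> 'a"
    show "(\<Sum>v\<in>B. mscale (u v) v) \<in> W"
      unfolding W by (intro msp.span_sum msp.span_scale msp.span_base)
  next
    fix x assume "x \<in> W"
    then obtain u where u: "x = (\<Sum>v\<in>B. mscale (u v) v)"
      unfolding W msp.span_finite[OF fin] by auto
    show "\<exists>u\<in>B \<rightarrow>\<^sub>E UNIV. x = (\<Sum>v\<in>B. mscale (u v) v)"
      by (rule bexI[of _ "restrict u B"]) (auto simp: u intro: sum.cong)
  qed
  then have "card W = card (B \<rightarrow>\<^sub>E (UNIV::'a set))" by (simp add: bij_betw_same_card)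
  then show ?thesis using B(4) by (simp add: card_PiE)
qed

text \<open>Each fibre of \<open>f\<close> is one orbit of the q - 1 nonzero scalars. Used with
  \<open>f\<close> the span of a matrix to count points, and with \<open>f = hyperplane_of\<close>
  to count hyperplanes.\<close>

lemma card_projective_image:
  fixes S :: "('a::{field,finite}^3^3) set"
  assumes closed: "\<And>c M. M \<in> S \<Longrightarrow> c \<noteq> 0 \<Longrightarrow> mscale c M \<in> S" and "0 \<notin> S"
    and f: "\<And>M M'. M \<in> S \<Longrightarrow> M' \<in> S \<Longrightarrow> f M = f M' \<longleftrightarrow> (\<exists>c. c \<noteq> 0 \<and> M' = mscale c M)"
  shows "card S = (CARD('a) - 1) * card (f ` S)"
proof -
  have fib: "card {M' \<in> S. f M' = f M} = CARD('a) - 1" if MS: "M \<in> S" for M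
  proof -
    have "M \<noteq> 0" using MS assms(2) by auto
    have "{M' \<in> S. f M' = f M} = (\<lambda>c. mscale c M) ` (UNIV - {0})"
    proof (intro equalityI subsetI)
      fix M' assume "M' \<in> {M' \<in> S. f M' = f M}"
      then obtain c where "c \<noteq> 0" "M' = mscale c M" using f[OF MS, of M'] by auto
      then show "M' \<in> (\<lambda>c. mscale c M) ` (UNIV - {0})" by blast
    next
      fix M' assume "M' \<in> (\<lambda>c. mscale c M) ` (UNIV - {0})"
      then obtain c where c: "c \<noteq> 0" "M' = mscale c M" by blast
      then have "M' \<in> S" using closed[OF MS] by blast
      then show "M' \<in> {M' \<in> S. f M' = f M}" using f[OF MS, of M'] c by auto
    qed
    moreover have "inj_on (\<lambda>c. mscale c M) (UNIV - {0})"
      using \<open>M \<noteq> 0\<close> by (auto simp: inj_on_def)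
    ultimately show ?thesis by (simp add: card_image card_Diff_singleton)
  qed
  have "card S = (\<Sum>y\<in>f ` S. card {M' \<in> S. f M' = y})"
    using sum.image_gen[of S "\<lambda>_. 1::nat" f] by simp
  also have "\<dots> = (\<Sum>y\<in>f ` S. CARD('a) - 1)"
    using fib by (intro sum.cong) auto
  finally show ?thesis by simp
qed

section \<open>Point-orbit distributions\<close>

lemma subspace_nucleus_plane: "msp.subspace (nucleus_plane :: ('a::field^3^3) set)"
  by (auto simp: msp.subspace_def mem_nucleus_plane_iff sym_mats_iff mscale_def)

lemma subspace_sym_mats: "msp.subspace (sym_mats :: ('a::field^3^3) set)"
  by (auto simp: msp.subspace_def sym_mats_iff mscale_def)

lemma span_singleton_eq_iff:
  fixes M M' :: "'a::field^3^3"
  assumes "M \<noteq> 0" "M' \<noteq> 0"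
  shows "msp.span {M} = msp.span {M'} \<longleftrightarrow> (\<exists>c. c \<noteq> 0 \<and> M' = mscale c M)"
proof
  assume "msp.span {M} = msp.span {M'}"
  then have "M' \<in> msp.span {M}" by (simp add: msp.span_base)
  then obtain c where "M' = mscale c M" by (auto simp: msp.span_singleton)
  then show "\<exists>c. c \<noteq> 0 \<and> M' = mscale c M" using assms(2) by force
next
  assume "\<exists>c. c \<noteq> 0 \<and> M' = mscale c M"
  then obtain c where c: "c \<noteq> 0" "M' = mscale c M" by blast
  have "M' \<in> msp.span {M}" using c(2) by (simp add: msp.span_base msp.span_scale)
  moreover have "M = mscale (inverse c) M'" using c by simp
  then have "M \<in> msp.span {M'}" by (metis insertI1 msp.span_base msp.span_scale)
  ultimately show "msp.span {M} = msp.span {M'}"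
    by (simp add: msp.span_eq)
qed

lemma PG5_0_iff:
  "P \<in> PG5 0 \<longleftrightarrow> (\<exists>M \<in> sym_mats. M \<noteq> 0 \<and> P = msp.span {M})"
proof
  assume "P \<in> PG5 0"
  then have P: "msp.subspace P" "P \<subseteq> sym_mats" "msp.dim P = 1" by (simp_all add: PG5_def)
  obtain B where B: "B \<subseteq> P" "msp.independent B" "P \<subseteq> msp.span B" "card B = msp.dim P"
    using msp.basis_exists by blast
  then obtain M where M: "B = {M}" using P(3) card_1_singletonE by metis
  moreover have "M \<noteq> 0" using B(2) M by auto
  moreover have "P = msp.span {M}"
    using B M P(1) by (simp add: msp.span_minimal subset_antisym)
  ultimately show "\<exists>M \<in> sym_mats. M \<noteq> 0 \<and> P = msp.span {M}" using B(1) P(2) by auto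
next
  assume "\<exists>M \<in> sym_mats. M \<noteq> 0 \<and> P = msp.span {M}"
  then obtain M where M: "M \<in> sym_mats" "M \<noteq> 0" "P = msp.span {M}" by blast
  then have "P \<subseteq> sym_mats" by (simp add: msp.span_minimal subspace_sym_mats)
  moreover have "msp.dim P = 1"
    using M msp.dim_span_eq_card_independent[of "{M}"] by simp
  ultimately show "P \<in> PG5 0" using M by (simp add: PG5_def)
qed

text \<open>All nonzero multiples of a matrix have the same rank, so a single generator
  decides.\<close>

lemma points_of_rank_iff:
  "P \<in> points_of_rank k \<longleftrightarrow> (\<exists>M \<in> sym_mats. M \<noteq> 0 \<and> rank M = k \<and> P = msp.span {M})"
proof -
  have "(\<forall>M' \<in> msp.span {M} - {0}. rank M' = k) \<longleftrightarrow> rank M = k" if "M \<noteq> 0" for M :: "'a^3^3"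
  proof
    assume "\<forall>M' \<in> msp.span {M} - {0}. rank M' = k"
    then show "rank M = k" using that by (simp add: msp.span_base)
  next
    assume "rank M = k"
    moreover have "\<exists>c. c \<noteq> 0 \<and> M' = mscale c M" if "M' \<in> msp.span {M} - {0}" for M'
      using that by (auto simp: msp.span_singleton)
    ultimately show "\<forall>M' \<in> msp.span {M} - {0}. rank M' = k"
      using rank_mscale by blast
  qed
  then show ?thesis by (auto simp: points_of_rank_def PG5_0_iff)
qed

lemma points_of_rank_in_subspace:
  assumes "msp.subspace U" "U \<subseteq> sym_mats"
  shows "{P \<in> points_of_rank k. P \<subseteq> U} = (\<lambda>M. msp.span {M}) ` {M \<in> U. M \<noteq> 0 \<and> rank M = k}"
proof (intro equalityI subsetI)
  fix P assume "P \<in> {P \<in> points_of_rank k. P \<subseteq> U}"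
  then obtain M where "M \<noteq> 0" "rank M = k" "P = msp.span {M}" "P \<subseteq> U"
    by (auto simp: points_of_rank_iff)
  then show "P \<in> (\<lambda>M. msp.span {M}) ` {M \<in> U. M \<noteq> 0 \<and> rank M = k}"
    using msp.span_base[of M "{M}"] by blast
next
  fix P assume "P \<in> (\<lambda>M. msp.span {M}) ` {M \<in> U. M \<noteq> 0 \<and> rank M = k}"
  then obtain M where M: "M \<in> U" "M \<noteq> 0" "rank M = k" "P = msp.span {M}" by blast
  then have "P \<subseteq> U" using assms(1) by (simp add: msp.span_minimal)
  then show "P \<in> {P \<in> points_of_rank k. P \<subseteq> U}" using M assms(2) by (auto simp: points_of_rank_iff)
qed

text \<open>A point lies in \<open>U\<close> exactly when its generator does; matrices outside
  \<open>U\<close> are automatically nonzero.\<close>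

lemma points_of_rank_off_subspace:
  fixes W :: "('a::field^3^3) set"
  assumes "msp.subspace W" "W \<subseteq> sym_mats" "msp.subspace U"
  shows "{P \<in> points_of_rank k. P \<subseteq> W \<and> \<not> P \<subseteq> U} =
    (\<lambda>M. msp.span {M}) ` {M \<in> W - U. rank M = k}"
proof -
  have "msp.span {M} \<subseteq> U \<longleftrightarrow> M \<in> U" for M
    using assms(3) msp.span_base[of M "{M}"] msp.span_minimal[of "{M}" U] by auto
  moreover have "0 \<in> U" using assms(3) by (rule msp.subspace_0)
  moreover have "{P \<in> points_of_rank k. P \<subseteq> W \<and> \<not> P \<subseteq> U} =
      {P \<in> (\<lambda>M. msp.span {M}) ` {M \<in> W. M \<noteq> 0 \<and> rank M = k}. \<not> P \<subseteq> U}"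
    unfolding points_of_rank_in_subspace[OF assms(1,2), symmetric] by auto
  moreover have "{P \<in> f ` S. \<not> P \<subseteq> U} = f ` {M \<in> S. \<not> f M \<subseteq> U}" for f :: "'a^3^3 \<Rightarrow> _" and S
    by auto
  moreover have "{M \<in> {M \<in> W. M \<noteq> 0 \<and> rank M = k}. M \<notin> U} = {M \<in> W - U. rank M = k}"
    using \<open>0 \<in> U\<close> by auto
  ultimately show ?thesis by simp
qed

lemma card_points:
  fixes S :: "('a::{field,finite}^3^3) set"
  assumes "\<And>c M. M \<in> S \<Longrightarrow> c \<noteq> 0 \<Longrightarrow> mscale c M \<in> S" "0 \<notin> S"
  shows "card S = (CARD('a) - 1) * card ((\<lambda>M. msp.span {M}) ` S)"
  by (rule card_projective_image[OF assms])
    (use assms(2) in \<open>auto intro!: span_singleton_eq_iff\<close>)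

lemma card_field_ge_2: "2 \<le> CARD('a::{field,finite})"
proof -
  have "card {0, 1 :: 'a} \<le> CARD('a)" by (rule card_mono) auto
  then show ?thesis by simp
qed

text \<open>The point-orbit condition with vectors counted instead of points, which makes invariance
  under congruence easy. The size q^2 of the intersection says that it is a projective line.\<close>

definition good_plane :: "('a::{field,finite}^3^3) set \<Rightarrow> bool" where
  "good_plane W \<longleftrightarrow> msp.subspace W \<and> W \<subseteq> sym_mats \<and> card W = CARD('a) ^ 3 \<and>
     card (W \<inter> nucleus_plane) = CARD('a)\<^sup>2 \<and> (\<forall>M \<in> W - nucleus_plane. det M \<noteq> 0)"

text \<open>Each entry of the distribution counts a set of nonzero vectors divided by q - 1.\<close>

lemma good_plane_iff:
  fixes W :: "('a::{field,finite}^3^3) set"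
  assumes char2: "(2::'a) = 0"
  shows "good_plane W \<longleftrightarrow>
    W \<in> planes \<and> point_orbit_distribution W = [0, CARD('a) + 1, 0, (CARD('a))\<^sup>2]"
proof (cases "msp.subspace W \<and> W \<subseteq> sym_mats")
  case False
  then show ?thesis by (auto simp: good_plane_def PG5_def)
next
  case True
  then have W: "msp.subspace W" "W \<subseteq> sym_mats" by auto
  let ?q = "CARD('a)" and ?N = "nucleus_plane :: ('a^3^3) set"
  let ?sp = "\<lambda>M :: 'a^3^3. msp.span {M}"
  have q: "2 \<le> ?q" by (rule card_field_ge_2)
  have planes: "W \<in> planes \<longleftrightarrow> card W = ?q ^ 3"
    using W q by (simp add: PG5_def card_subspace power_inject_exp)
  have WN: "msp.subspace (W \<inter> ?N)" "W \<inter> ?N \<subseteq> sym_mats"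
    using W msp.subspace_inter subspace_nucleus_plane by auto
  have zero: "0 \<in> W" "0 \<in> ?N"
    using W(1) subspace_nucleus_plane by (auto intro: msp.subspace_0)
  \<comment> \<open>This confines the points of rank 1 and 3 to the complement of the nucleus plane,
    while every point of \<open>W\<close> inside it counts towards the second entry.\<close>
  have rN: "rank M = 2" if "M \<in> ?N" "M \<noteq> 0" for M
    using rank_nucleus[OF char2] that .
  have p1: "{P \<in> points_of_rank 1. P \<subseteq> W} = ?sp ` {M \<in> W - ?N. rank M = 1}"
    unfolding points_of_rank_in_subspace[OF W] using rN zero by (intro arg_cong[of _ _ "image ?sp"]) force
  have "{P \<in> points_of_rank 2. P \<subseteq> W \<and> P \<subseteq> ?N} = {P \<in> points_of_rank 2. P \<subseteq> W \<inter> ?N}" by auto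
  also have "\<dots> = ?sp ` (W \<inter> ?N - {0})"
    unfolding points_of_rank_in_subspace[OF WN] using rN by (intro arg_cong[of _ _ "image ?sp"]) auto
  finally have p2n: "{P \<in> points_of_rank 2. P \<subseteq> W \<and> P \<subseteq> ?N} = ?sp ` (W \<inter> ?N - {0})" .
  note p2s = points_of_rank_off_subspace[OF W subspace_nucleus_plane, of 2]
  have p3: "{P \<in> points_of_rank 3. P \<subseteq> W} = ?sp ` {M \<in> W - ?N. rank M = 3}"
    unfolding points_of_rank_in_subspace[OF W] using rN zero by (intro arg_cong[of _ _ "image ?sp"]) force
  have cN: "card (W \<inter> ?N) = 1 + (?q - 1) * card (?sp ` (W \<inter> ?N - {0}))"
  proof -
    have "card (W \<inter> ?N - {0}) = (?q - 1) * card (?sp ` (W \<inter> ?N - {0}))"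
      using msp.subspace_scale[OF WN(1)] by (intro card_points) auto
    moreover have "card (W \<inter> ?N) = Suc (card (W \<inter> ?N - {0}))"
      using zero by (intro card.remove) auto
    ultimately show ?thesis by simp
  qed
  \<comment> \<open>The zero matrix together with the q + 1 points of a line, each carrying q - 1
    vectors.\<close>
  have sq: "?q\<^sup>2 = 1 + (?q - 1) * (?q + 1)"
    using q by (cases ?q) (auto simp: power2_eq_square)
  show ?thesis
  proof
    assume g: "good_plane W"
    then have r3: "rank M = 3" if "M \<in> W - ?N" for M
      using that by (auto simp: good_plane_def rank_eq_3_iff)
    have "(?q - 1) * card (?sp ` (W \<inter> ?N - {0})) = (?q - 1) * (?q + 1)"
      using g[unfolded good_plane_def] cN sq by linarith
    then have c2: "card (?sp ` (W \<inter> ?N - {0})) = ?q + 1"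
      unfolding mult_cancel1 using q by linarith
    have sub: "mscale c M \<in> W - ?N" if "M \<in> W - ?N" "c \<noteq> 0" for c M
    proof -
      have "mscale c M \<notin> ?N"
      proof
        assume "mscale c M \<in> ?N"
        then have "mscale (inverse c) (mscale c M) \<in> ?N"
          by (rule msp.subspace_scale[OF subspace_nucleus_plane])
        then show False using that by simp
      qed
      then show ?thesis using that W(1) by (simp add: msp.subspace_scale)
    qed
    have "card (W - ?N) = (?q - 1) * card (?sp ` (W - ?N))"
      using sub zero by (intro card_points) auto
    moreover have "card (W - ?N) = ?q ^ 3 - ?q\<^sup>2"
      using g card_Diff_subset_Int[of W ?N] by (simp add: good_plane_def)
    moreover have "?q ^ 3 - ?q\<^sup>2 = (?q - 1) * ?q\<^sup>2"
      by (simp add: power3_eq_cube power2_eq_square diff_mult_distrib)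
    ultimately have "(?q - 1) * card (?sp ` (W - ?N)) = (?q - 1) * ?q\<^sup>2" by presburger
    then have c3: "card (?sp ` (W - ?N)) = ?q\<^sup>2"
      unfolding mult_cancel1 using q by linarith
    have e: "{M \<in> W - ?N. rank M = 1} = {}" "{M \<in> W - ?N. rank M = 2} = {}"
      "{M \<in> W - ?N. rank M = 3} = W - ?N"
      using r3 by auto
    show "W \<in> planes \<and> point_orbit_distribution W = [0, ?q + 1, 0, ?q\<^sup>2]"
      unfolding point_orbit_distribution_def p1 p2n p2s p3 e c2 c3
      using g planes by (simp add: good_plane_def)
  next
    assume "W \<in> planes \<and> point_orbit_distribution W = [0, ?q + 1, 0, ?q\<^sup>2]"
    then have pl: "card W = ?q ^ 3" and c: "card (?sp ` {M \<in> W - ?N. rank M = 1}) = 0"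
      "card (?sp ` (W \<inter> ?N - {0})) = ?q + 1" "card (?sp ` {M \<in> W - ?N. rank M = 2}) = 0"
      unfolding planes point_orbit_distribution_def p1 p2n p2s p3 by auto
    have "card (W \<inter> ?N) = ?q\<^sup>2" using cN c(2) sq by simp
    moreover have "det M \<noteq> 0" if M: "M \<in> W - ?N" for M
    proof -
      \<comment> \<open>A zero count of points means that no matrix outside the nucleus plane has
        rank 1 or 2; rank 0 is excluded because the zero matrix lies in the nucleus plane.\<close>
      have "rank M \<noteq> 1" "rank M \<noteq> 2" using c(1,3) M by auto
      moreover have "rank M \<noteq> 0" using M zero by (auto simp: rank_eq_0_iff)
      ultimately have "rank M = 3" using rank_le_3[of M] by linarith
      then show ?thesis by (simp add: rank_eq_3_iff)
    qed
    ultimately show "good_plane W" using W pl by (simp add: good_plane_def)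
  qed
qed

section \<open>Classification under congruence\<close>

lemma K_act_mult: "K_act A (K_act B W) = K_act (A ** B) W"
  by (simp add: K_act_def image_image matrix_transpose_mul matrix_mul_assoc)

lemma K_act_mat_1 [simp]: "K_act (mat 1) W = W"
  by (simp add: K_act_def transpose_mat)

lemma matrix_inv_cancel:
  assumes "invertible (A :: 'a::field^3^3)"
  obtains B where "A ** B = mat 1" "B ** A = mat 1" "invertible B"
  using assms unfolding invertible_def by blast

lemma inj_congruence:
  assumes "invertible (A :: 'a::field^3^3)"
  shows "inj (\<lambda>M. A ** M ** transpose A)"
proof -
  obtain B where B: "B ** A = mat 1" using assms matrix_inv_cancel by blast
  have "B ** (A ** M ** transpose A) ** transpose B = (B ** A) ** M ** transpose (B ** A)" for M
    by (simp add: matrix_transpose_mul matrix_mul_assoc)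
  then have "B ** (A ** M ** transpose A) ** transpose B = M" for M
    by (simp add: B transpose_mat)
  then show ?thesis by (intro inj_on_inverseI[where g = "\<lambda>M. B ** M ** transpose B"])
qed

lemma congruence_sym_mats: "M \<in> sym_mats \<Longrightarrow> A ** M ** transpose A \<in> sym_mats"
  by (simp add: sym_mats_def matrix_transpose_mul matrix_mul_assoc)

text \<open>The mixed terms come in equal pairs and cancel. Since the coefficients left are squares,
  the vector of square roots of the diagonal transforms linearly by \<open>A\<close>.\<close>

lemma congruence_diag:
  fixes M :: "'a::field^3^3"
  assumes char2: "(2::'a) = 0" and M: "M \<in> sym_mats"
  shows "(A ** M ** transpose A) $ i $ i = (\<Sum>k\<in>UNIV. (A $ i $ k)\<^sup>2 * M $ k $ k)"
proof -
  have "(A ** M ** transpose A) $ i $ i = (\<Sum>k\<in>UNIV. (A $ i $ k)\<^sup>2 * M $ k $ k)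
    + 2 * (A$i$0 * A$i$1 * M$0$1 + A$i$0 * A$i$2 * M$0$2 + A$i$1 * A$i$2 * M$1$2)"
    using M by (simp add: matrix_matrix_mult_def transpose_def sum_UNIV3 sym_mats_iff
        power2_eq_square algebra_simps)
  then show ?thesis by (simp add: char2)
qed

lemma congruence_nucleus:
  fixes M :: "'a::field^3^3"
  assumes "(2::'a) = 0" "M \<in> nucleus_plane"
  shows "A ** M ** transpose A \<in> nucleus_plane"
  using assms congruence_diag[OF assms(1), of M A] congruence_sym_mats[of M A]
  by (simp add: nucleus_plane_def)

text \<open>One inclusion holds for every matrix; applied to the inverse it yields the
  other.\<close>

lemma K_act_nucleus:
  assumes char2: "(2::'a::field) = 0" and "invertible A"
  shows "K_act A (nucleus_plane :: ('a^3^3) set) = nucleus_plane"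
proof
  show sub: "K_act A (nucleus_plane :: ('a^3^3) set) \<subseteq> nucleus_plane" for A
    using congruence_nucleus[OF char2] by (auto simp: K_act_def)
  obtain B where "A ** B = mat 1" using assms(2) matrix_inv_cancel by blast
  then have "nucleus_plane = K_act A (K_act B nucleus_plane)" by (simp add: K_act_mult)
  also have "\<dots> \<subseteq> K_act A nucleus_plane"
    using sub[of B] by (auto simp: K_act_def)
  finally show "nucleus_plane \<subseteq> K_act A nucleus_plane" .
qed

lemma congruence_linear: "Vector_Spaces.linear mscale mscale (\<lambda>M. A ** M ** transpose A)"
  by unfold_locales
    (auto simp: vec_eq_iff matrix_matrix_mult_def mscale_def sum_UNIV3 algebra_simps)

text \<open>Congruence is linear and injective, preserves the nucleus plane, and multiplies
  determinants by the nonzero square of \<open>det A\<close>.\<close>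

lemma good_plane_K_act:
  fixes W :: "('a::{field,finite}^3^3) set"
  assumes char2: "(2::'a) = 0" and A: "invertible A" and W: "good_plane W"
  shows "good_plane (K_act A W)"
proof -
  let ?f = "\<lambda>M. A ** M ** transpose A"
  have inj: "inj ?f" using A by (rule inj_congruence)
  interpret lin: Vector_Spaces.linear mscale mscale ?f by (rule congruence_linear)
  have int: "K_act A W \<inter> nucleus_plane = K_act A (W \<inter> nucleus_plane)"
    \<comment> \<open>Writing the nucleus plane as its own image lets the intersection pass through
      the injective map.\<close>
    by (subst K_act_nucleus[OF char2 A, symmetric]) (simp only: K_act_def image_Int[OF inj])
  have diff: "K_act A W - nucleus_plane = K_act A (W - nucleus_plane)"
    by (subst K_act_nucleus[OF char2 A, symmetric]) (simp only: K_act_def image_set_diff[OF inj])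
  have card: "card (K_act A U) = card U" for U
    unfolding K_act_def using inj by (simp add: card_image inj_on_subset)
  have "msp.subspace (K_act A W)"
    using W unfolding K_act_def good_plane_def by (blast intro: lin.subspace_image)
  moreover have "K_act A W \<subseteq> sym_mats"
    using W congruence_sym_mats by (auto simp: K_act_def good_plane_def)
  moreover have "det M \<noteq> 0" if M: "M \<in> K_act A W - nucleus_plane" for M
  proof -
    obtain M0 where "M0 \<in> W - nucleus_plane" "M = ?f M0" using M diff by (auto simp: K_act_def)
    then show ?thesis using W A by (simp add: good_plane_def det_mul invertible_det_nz)
  qed
  ultimately show ?thesis using W int card by (simp add: good_plane_def)
qed

definition sigma16_plane :: "('a::field^3^3) set" where
  "sigma16_plane = {smat 0 0 z y x z | x y z. True}"

lemma card_range_triple: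
  fixes h :: "'a::{field,finite} \<times> 'a \<times> 'a \<Rightarrow> 'b"
  assumes "inj h" shows "card (range h) = CARD('a) ^ 3"
  using assms by (simp add: card_image power3_eq_cube)

text \<open>The nucleus line is z = 0, and elsewhere the determinant is z^3.\<close>

lemma good_plane_sigma16_plane:
  assumes char2: "(2::'a::{field,finite}) = 0"
  shows "good_plane (sigma16_plane :: ('a^3^3) set)"
proof -
  have rng: "sigma16_plane = range (\<lambda>(x, y, z :: 'a). smat 0 0 z y x z)"
    by (force simp: sigma16_plane_def image_def)
  have N: "sigma16_plane \<inter> nucleus_plane = range (\<lambda>(x, y :: 'a). smat 0 0 0 y x 0)"
    by (auto simp: sigma16_plane_def image_def smat_eq_iff)
  have "card (sigma16_plane :: ('a^3^3) set) = CARD('a) ^ 3"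
    unfolding rng by (rule card_range_triple) (auto simp: inj_def smat_eq_iff)
  moreover have "card (sigma16_plane \<inter> nucleus_plane :: ('a^3^3) set) = CARD('a)\<^sup>2"
    unfolding N by (subst card_image) (auto simp: inj_def smat_eq_iff power2_eq_square)
  moreover have "msp.subspace (sigma16_plane :: ('a^3^3) set)"
    unfolding msp.subspace_def sigma16_plane_def by (auto simp: smat_eq_iff smat_zero[symmetric])
  moreover have "det M \<noteq> 0" if M: "M \<in> sigma16_plane - nucleus_plane" for M :: "'a^3^3"
  proof -
    obtain x y z where "M = smat 0 0 z y x z" "z \<noteq> 0" using M by (auto simp: sigma16_plane_def)
    then show ?thesis using det_sym_char2[OF char2, of M] by simp
  qed
  ultimately show ?thesis by (auto simp: good_plane_def sigma16_plane_def)
qed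

text \<open>Here \<open>det (M + cL) = det M + (c t)\<^sup>2\<close> with \<open>t\<close> the value of the linear form below, so \<open>t \<noteq> 0\<close>
  would produce a singular matrix of \<open>W\<close> outside the nucleus plane.\<close>

lemma good_plane_nucleus_form:
  fixes W :: "('a::{field,finite}^3^3) set"
  assumes char2: "(2::'a) = 0" and W: "good_plane W"
    and M: "M \<in> W" "M \<notin> nucleus_plane" and L: "L \<in> W" "L \<in> nucleus_plane"
    and v: "v0\<^sup>2 = M$0$0" "v1\<^sup>2 = M$1$1" "v2\<^sup>2 = M$2$2"
  shows "v0 * L$1$2 + v1 * L$0$2 + v2 * L$0$1 = 0" (is "?t = 0")
proof (rule ccontr)
  assume t: "?t \<noteq> 0"
  obtain s where s: "s\<^sup>2 = det M" using char2_sqrt[OF char2] .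
  \<comment> \<open>Chosen so that \<open>(c * ?t)^2 = det M\<close>; the new determinant is then
    \<open>2 * det M = 0\<close>.\<close>
  define c where "c = s / ?t"
  have sq: "(x + y)\<^sup>2 = x\<^sup>2 + y\<^sup>2" for x y :: 'a
    using char2 by (simp add: power2_sum)
  have sub: "msp.subspace W" "W \<subseteq> sym_mats" using W by (auto simp: good_plane_def)
  have sym: "M \<in> sym_mats" "L \<in> sym_mats" using sub M L by auto
  have Ld: "L$0$0 = 0" "L$1$1 = 0" "L$2$2 = 0" using L by (auto simp: mem_nucleus_plane_iff)
  let ?M' = "M + mscale c L"
  have W': "?M' \<in> W" using sub M L by (simp add: msp.subspace_add msp.subspace_scale)
  have diag: "?M'$0$0 = M$0$0" "?M'$1$1 = M$1$1" "?M'$2$2 = M$2$2"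
    by (simp_all add: mscale_def Ld)
  have "?M' \<notin> nucleus_plane"
    using M(2) sym(1) diag by (simp add: mem_nucleus_plane_iff)
  then have "det ?M' \<noteq> 0" using W W' by (simp add: good_plane_def)
  \<comment> \<open>Adding a multiple of \<open>L\<close> leaves the diagonal alone, and the
    off-diagonal entries enter the determinant only through their squares, which are
    additive.\<close>
  moreover have "det ?M' = det M + (c * ?t)\<^sup>2"
    using sub(2) W' det_sym_char2[OF char2, of ?M'] det_sym_char2[OF char2, of M] sym(1)
    unfolding diag v[symmetric]
    by (simp add: subset_iff mscale_def sq power_mult_distrib algebra_simps)
  then have "det ?M' = det M + s\<^sup>2" using t by (simp add: c_def)
  then have "det ?M' = 2 * det M" by (simp add: s)
  ultimately show False using char2 by simp
qed

text \<open>The column \<open>v\<close> is completed by the two unit vectors that omit a coordinate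
  where \<open>v\<close> is nonzero.\<close>

lemma exists_invertible_last_column:
  fixes v :: "'a::field^3"
  assumes "v \<noteq> 0"
  obtains B :: "'a^3^3" where "invertible B" "column 2 B = v"
proof -
  define C :: "'a^3 \<Rightarrow> 'a^3 \<Rightarrow> 'a^3^3"
    where "C x y = (\<chi> i j. if j = 0 then x$i else if j = 1 then y$i else v$i)" for x y
  have col: "column 2 (C x y) = v" for x y by (simp add: C_def column_def vec_eq_iff)
  have "v$0 \<noteq> 0 \<or> v$1 \<noteq> 0 \<or> v$2 \<noteq> 0" using assms by (simp add: vec_eq_iff all3)
  then have "\<exists>x y. det (C x y) \<noteq> 0"
  proof (elim disjE)
    assume "v$0 \<noteq> 0"
    then have "det (C (axis 1 1) (axis 2 1)) \<noteq> 0" by (simp add: det3 C_def axis_def)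
    then show ?thesis by blast
  next
    assume "v$1 \<noteq> 0"
    then have "det (C (axis 0 1) (axis 2 1)) \<noteq> 0" by (simp add: det3 C_def axis_def)
    then show ?thesis by blast
  next
    assume "v$2 \<noteq> 0"
    then have "det (C (axis 0 1) (axis 1 1)) \<noteq> 0" by (simp add: det3 C_def axis_def)
    then show ?thesis by blast
  qed
  then show ?thesis using that col by (metis invertible_det_nz)
qed

text \<open>Here the square roots of the diagonal are (0, 0, 1), so the nucleus line of
  \<open>W\<close> satisfies \<open>L$0$1 = 0\<close>. It is thereby known completely, and together
  with \<open>M\<close> it generates \<open>W\<close>.\<close>

lemma good_plane_normal_form:
  fixes W :: "('a::{field,finite}^3^3) set"
  assumes char2: "(2::'a) = 0" and W: "good_plane W"
    and M: "M \<in> W" "M$0$0 = 0" "M$1$1 = 0" "M$2$2 = 1"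
  obtains D where "invertible D" "W = K_act D sigma16_plane"
proof -
  have sub: "msp.subspace W" "W \<subseteq> sym_mats" using W by (auto simp: good_plane_def)
  have MN: "M \<notin> nucleus_plane" using M(4) by (auto simp: mem_nucleus_plane_iff)
  let ?F = "range (\<lambda>(d, e :: 'a). smat 0 0 0 d e 0)"
  have "W \<inter> nucleus_plane \<subseteq> ?F"
  proof
    fix L assume L: "L \<in> W \<inter> nucleus_plane"
    then have "L$0$1 = 0"
      using good_plane_nucleus_form[OF char2 W M(1) MN, of L 0 0 1] M by simp
    then have "L = smat 0 0 0 (L$1$2) (L$0$2) 0"
      using L sym_mats_eq_smat[of L] by (simp add: mem_nucleus_plane_iff)
    then show "L \<in> ?F" by (intro image_eqI[of _ _ "(L$1$2, L$0$2)"]) auto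
  qed
  moreover have "card ?F = CARD('a)\<^sup>2"
    by (subst card_image) (auto simp: inj_def smat_eq_iff power2_eq_square)
  \<comment> \<open>Both sides have q^2 elements, so the inclusion is an equality.\<close>
  ultimately have F: "W \<inter> nucleus_plane = ?F"
    using W by (intro card_subset_eq) (auto simp: good_plane_def)
  define f where "f = M$0$1"
  have Meq: "M = smat 0 0 1 (M$1$2) (M$0$2) f"
    using sym_mats_eq_smat[of M] M sub(2) by (auto simp: f_def)
  have "det M \<noteq> 0" using W M(1) MN by (simp add: good_plane_def)
  then have f: "f \<noteq> 0" using det_sym_char2[OF char2, of M] sub(2) M by (auto simp: f_def)
  \<comment> \<open>The multiple \<open>z\<close> of \<open>M\<close> has the right diagonal and the
    right entry \<open>f * z\<close>; the other two entries are corrected by an element of the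
    nucleus line.\<close>
  have mem: "smat 0 0 z d e (f * z) \<in> W" for z d e
  proof -
    have "smat 0 0 0 (d - z * M$1$2) (e - z * M$0$2) 0 \<in> W" using F by (force simp: image_iff)
    moreover have "mscale z (smat 0 0 1 (M$1$2) (M$0$2) f) \<in> W"
      using sub(1) M(1) Meq by (simp only: msp.subspace_scale)
    ultimately have "mscale z (smat 0 0 1 (M$1$2) (M$0$2) f)
        + smat 0 0 0 (d - z * M$1$2) (e - z * M$0$2) 0 \<in> W"
      using sub(1) by (simp only: msp.subspace_add)
    then show ?thesis by (simp add: mult.commute)
  qed
  \<comment> \<open>The diagonal matrix with entries f, 1, 1 multiplies the entry at (0, 1) by
    \<open>f\<close> and so turns the relation of the representative into that of
    \<open>W\<close>.\<close>
  define D :: "'a^3^3" where "D = smat f 1 1 0 0 0"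
  have D: "invertible D" using f by (simp add: invertible_det_nz det3 D_def)
  have "D ** smat 0 0 z y x z ** transpose D = smat 0 0 z y (f * x) (f * z)" for x y z
    by (simp add: vec_eq_iff all3 matrix_matrix_mult_def transpose_def sum_UNIV3 D_def)
  then have "K_act D sigma16_plane \<subseteq> W" using mem by (auto simp: K_act_def sigma16_plane_def)
  moreover have "card (K_act D sigma16_plane) = card W"
    using good_plane_K_act[OF char2 D good_plane_sigma16_plane[OF char2]] W by (simp add: good_plane_def)
  ultimately have "W = K_act D sigma16_plane" by (metis card_subset_eq finite)
  with D show ?thesis by (rule that)
qed

text \<open>Square roots of the diagonal transform linearly, so the inverse of a matrix with last
  column \<open>v\<close> moves them to (0, 0, 1).\<close>

lemma good_plane_K_equiv:
  fixes W :: "('a::{field,finite}^3^3) set"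
  assumes char2: "(2::'a) = 0" and W: "good_plane W"
  obtains A where "invertible A" "W = K_act A sigma16_plane"
proof -
  \<comment> \<open>Comparing q^2 with q^3 produces a matrix of \<open>W\<close> off the nucleus
    plane.\<close>
  have "card (W \<inter> nucleus_plane) < card W"
    using W card_field_ge_2[where 'a='a] by (simp add: good_plane_def power_strict_increasing)
  then obtain M where M: "M \<in> W" "M \<notin> nucleus_plane"
    by (metis Int_absorb2 less_irrefl subsetI)
  have sym: "M \<in> sym_mats" using W M by (auto simp: good_plane_def)
  have "\<forall>i. \<exists>y. y\<^sup>2 = M$i$i" using char2_sqrt[OF char2] by metis
  then obtain u where u: "\<And>i. (u i)\<^sup>2 = M$i$i" by metis
  define v where "v = vec_lambda u"
  have v: "(v$i)\<^sup>2 = M$i$i" for i by (simp add: v_def u)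
  have "v \<noteq> 0"
    using M(2) sym v[of 0] v[of 1] v[of 2] by (auto simp: mem_nucleus_plane_iff)
  then obtain B :: "'a^3^3" where B: "invertible B" "column 2 B = v"
    using exists_invertible_last_column by blast
  obtain C where C: "B ** C = mat 1" "C ** B = mat 1" "invertible C"
    using matrix_inv_cancel[OF B(1)] .
  have sq: "(x + y)\<^sup>2 = x\<^sup>2 + y\<^sup>2" for x y :: 'a
    using char2 by (simp add: power2_sum)
  have "(C ** M ** transpose C) $ i $ i = ((C *v v) $ i)\<^sup>2" for i
    unfolding congruence_diag[OF char2 sym] v[symmetric]
    by (simp add: matrix_vector_mult_def sum_UNIV3 sq power_mult_distrib)
  moreover have "C *v v = axis 2 1"
  proof -
    \<comment> \<open>As \<open>v\<close> is the last column of \<open>B\<close>, its image is the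
      last column of \<open>C ** B\<close>, the identity.\<close>
    have "C *v v = column 2 (C ** B)"
      using B(2) by (auto simp: vec_eq_iff column_def matrix_vector_mult_def matrix_matrix_mult_def)
    then show ?thesis by (simp add: C(2) column_def mat_def axis_def vec_eq_iff)
  qed
  ultimately have d: "(C ** M ** transpose C) $ i $ i = (if i = 2 then 1 else 0)" for i
    by (simp add: axis_def)
  have "C ** M ** transpose C \<in> K_act C W" using M by (auto simp: K_act_def)
  from good_plane_normal_form[OF char2 good_plane_K_act[OF char2 C(3) W] this]
  obtain D where D: "invertible D" "K_act C W = K_act D sigma16_plane" by (auto simp: d)
  have "W = K_act (B ** D) sigma16_plane"
    by (metis C(1) D(2) K_act_mat_1 K_act_mult)
  moreover have "invertible (B ** D)" using B(1) D(1) by (rule invertible_mult)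
  ultimately show ?thesis using that by blast
qed

lemma good_planes_eq_K_orbit:
  assumes char2: "(2::'a::{field,finite}) = 0"
  shows "{W :: ('a^3^3) set. good_plane W} = K_orbit sigma16_plane"
  using good_plane_K_equiv[OF char2] good_plane_K_act[OF char2 _ good_plane_sigma16_plane[OF char2]]
  by (fastforce simp: K_orbit_def)

section \<open>Conics and hyperplanes\<close>

lemma qform_expand:
  "qform a x = a$0$0 * x$0 * x$0 + a$0$1 * x$0 * x$1 + a$0$2 * x$0 * x$2
    + a$1$1 * x$1 * x$1 + a$1$2 * x$1 * x$2 + a$2$2 * x$2 * x$2"
  by (simp add: qform_def sum_UNIV3 atLeast3 add.assoc)

lemma lform_expand: "lform l x = l$0 * x$0 + l$1 * x$1 + l$2 * x$2"
  by (simp add: lform_def sum_UNIV3)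

lemma mem_hyperplane_of:
  "M \<in> hyperplane_of a \<longleftrightarrow> M \<in> sym_mats \<and>
    a$0$0 * M$0$0 + a$0$1 * M$0$1 + a$0$2 * M$0$2 + a$1$1 * M$1$1 + a$1$2 * M$1$2 + a$2$2 * M$2$2 = 0"
  by (simp add: hyperplane_of_def sum_UNIV3 atLeast3 add.assoc)

lemma conic_coeffs_iff:
  "a \<in> conic_coeffs \<longleftrightarrow> a \<noteq> 0 \<and> a$1$0 = 0 \<and> a$2$0 = 0 \<and> a$2$1 = 0"
  by (simp add: conic_coeffs_def all3)

text \<open>The coefficients of \<open>x \<mapsto> Q(Bx)\<close>, where \<open>Q\<close> is the form with coefficients \<open>a\<close>.\<close>

definition conic_pullback :: "'a::field^3^3 \<Rightarrow> 'a^3^3 \<Rightarrow> 'a^3^3" where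
  "conic_pullback B a = (let C = transpose B ** a ** B in
     \<chi> i j. if j < i then 0 else if i = j then C$i$i else C$i$j + C$j$i)"

text \<open>\<open>qform\<close> reads only the upper triangle, whereas the triple product mixes all
  entries; hence the zeros required below the diagonal. Folding entry (j, i) into (i, j) involves no
  division by 2.\<close>

lemma qform_conic_pullback:
  assumes "a$1$0 = 0" "a$2$0 = 0" "a$2$1 = 0"
  shows "qform (conic_pullback B a) x = qform a (B *v x)"
  by (simp add: qform_expand conic_pullback_def Let_def matrix_matrix_mult_def matrix_vector_mult_def
      transpose_def sum_UNIV3 assms algebra_simps)

text \<open>Under the pairing of forms with symmetric matrices, pulling back along \<open>B\<close>
  is adjoint to congruence by \<open>B\<close>.\<close>

lemma congruence_mem_hyperplane_of:
  assumes "a$1$0 = 0" "a$2$0 = 0" "a$2$1 = 0" "M \<in> sym_mats"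
  shows "B ** M ** transpose B \<in> hyperplane_of a \<longleftrightarrow> M \<in> hyperplane_of (conic_pullback B a)"
proof -
  have sym: "M$1$0 = M$0$1" "M$2$0 = M$0$2" "M$2$1 = M$1$2"
    using assms(4) by (simp_all add: sym_mats_iff)
  have "B ** M ** transpose B \<in> sym_mats" using assms(4) by (rule congruence_sym_mats)
  then show ?thesis
    by (simp add: mem_hyperplane_of assms conic_pullback_def Let_def matrix_matrix_mult_def
      transpose_def sum_UNIV3 sym algebra_simps)
qed

text \<open>Two linear forms with the same kernel are proportional.\<close>

lemma hyperplane_of_eq_iff:
  fixes a b :: "'a::field^3^3"
  assumes "a \<in> conic_coeffs" "b \<in> conic_coeffs"
  shows "hyperplane_of a = hyperplane_of b \<longleftrightarrow> (\<exists>c. c \<noteq> 0 \<and> b = mscale c a)"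
proof -
  define p where "p d M = d$0$0 * M$0$0 + d$0$1 * M$0$1 + d$0$2 * M$0$2
    + d$1$1 * M$1$1 + d$1$2 * M$1$2 + d$2$2 * M$2$2" for d M :: "'a^3^3"
  have mem: "M \<in> hyperplane_of d \<longleftrightarrow> M \<in> sym_mats \<and> p d M = 0" for d M
    by (simp add: mem_hyperplane_of p_def)
  have low: "a$1$0 = 0" "a$2$0 = 0" "a$2$1 = 0" "b$1$0 = 0" "b$2$0 = 0" "b$2$1 = 0"
    using assms by (auto simp: conic_coeffs_iff)
  \<comment> \<open>Testing on the six elementary symmetric matrices recovers the
    coefficients.\<close>
  have ext: "b = mscale c a" if "\<And>M. M \<in> sym_mats \<Longrightarrow> p b M = c * p a M" for c
    using that[of "smat 1 0 0 0 0 0"] that[of "smat 0 1 0 0 0 0"] that[of "smat 0 0 1 0 0 0"]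
      that[of "smat 0 0 0 1 0 0"] that[of "smat 0 0 0 0 1 0"] that[of "smat 0 0 0 0 0 1"] low
    by (simp add: p_def vec_eq_iff all3 mscale_def)
  have nz: "a \<noteq> 0" "b \<noteq> 0" using assms by (auto simp: conic_coeffs_iff)
  show ?thesis
  proof
    assume "\<exists>c. c \<noteq> 0 \<and> b = mscale c a"
    then obtain c where c: "c \<noteq> 0" "b = mscale c a" by blast
    have "p b M = c * p a M" for M by (simp add: p_def c(2) mscale_def algebra_simps)
    then show "hyperplane_of a = hyperplane_of b" using c(1) by (intro Set.set_eqI) (simp add: mem)
  next
    assume eq: "hyperplane_of a = hyperplane_of b"
    have "\<exists>M \<in> sym_mats. p a M \<noteq> 0"
    proof (rule ccontr)
      assume "\<not> ?thesis"
      then have "sym_mats \<subseteq> hyperplane_of a" by (auto simp: mem)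
      then have "p b M = 0 * p a M" if "M \<in> sym_mats" for M using that eq by (auto simp: mem)
      then have "b = 0" using ext[of 0] by simp
      then show False using nz(2) by simp
    qed
    then obtain M where M: "M \<in> sym_mats" "p a M \<noteq> 0" by blast
    have "p b Z = p b M / p a M * p a Z" if Z: "Z \<in> sym_mats" for Z
    proof -
      \<comment> \<open>This combination lies in the kernel of \<open>p a\<close>, hence in that of
        \<open>p b\<close>.\<close>
      let ?Y = "mscale (p a M) Z - mscale (p a Z) M"
      have pY: "p d ?Y = p a M * p d Z - p a Z * p d M" for d
        by (simp add: p_def[of d] mscale_def algebra_simps)
      have "?Y \<in> sym_mats"
        using Z M(1)
        by (intro msp.subspace_diff[OF subspace_sym_mats] msp.subspace_scale[OF subspace_sym_mats])
      moreover have "p a ?Y = 0" by (simp add: pY mult.commute)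
      ultimately have "?Y \<in> hyperplane_of b" by (simp add: mem flip: eq)
      then have "p a M * p b Z = p a Z * p b M" by (simp add: mem pY)
      then show ?thesis using M(2) by (simp add: field_simps)
    qed
    then have "b = mscale (p b M / p a M) a" by (rule ext)
    then show "\<exists>c. c \<noteq> 0 \<and> b = mscale c a" using nz(2) by (metis msp.scale_zero_left)
  qed
qed

section \<open>Congruence acting on hyperplanes\<close>

lemma conic_pullback_lower [simp]:
  "conic_pullback B a $ 1 $ 0 = 0" "conic_pullback B a $ 2 $ 0 = 0" "conic_pullback B a $ 2 $ 1 = 0"
  by (simp_all add: conic_pullback_def Let_def)

text \<open>Points move by \<open>A\<close>, so forms are pulled back along its inverse
  \<open>B\<close>.\<close>

lemma K_act_hyperplane_of:
  assumes "A ** B = mat 1" "B ** A = mat 1" "a$1$0 = 0" "a$2$0 = 0" "a$2$1 = 0"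
  shows "K_act A (hyperplane_of a) = hyperplane_of (conic_pullback B a)"
proof -
  have inv: "C ** (D ** Z ** transpose D) ** transpose C = Z" if "C ** D = mat 1" for C D Z :: "'a^3^3"
  proof -
    have "C ** (D ** Z ** transpose D) ** transpose C = (C ** D) ** Z ** transpose (C ** D)"
      by (simp add: matrix_transpose_mul matrix_mul_assoc)
    then show ?thesis by (simp add: that transpose_mat)
  qed
  show ?thesis
  proof (intro equalityI subsetI)
    fix Z assume "Z \<in> K_act A (hyperplane_of a)"
    then obtain M where M: "M \<in> hyperplane_of a" "Z = A ** M ** transpose A" by (auto simp: K_act_def)
    then have "Z \<in> sym_mats" by (simp add: mem_hyperplane_of congruence_sym_mats)
    moreover have "B ** Z ** transpose B = M" by (simp add: M(2) inv assms(2))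
    ultimately show "Z \<in> hyperplane_of (conic_pullback B a)"
      using congruence_mem_hyperplane_of[OF assms(3-5)] M(1) by metis
  next
    fix Z assume Z: "Z \<in> hyperplane_of (conic_pullback B a)"
    then have "Z \<in> sym_mats" by (simp add: mem_hyperplane_of)
    then have "B ** Z ** transpose B \<in> hyperplane_of a"
      using congruence_mem_hyperplane_of[OF assms(3-5)] Z by metis
    moreover have "Z = A ** (B ** Z ** transpose B) ** transpose A" by (simp add: inv assms(1))
    ultimately show "Z \<in> K_act A (hyperplane_of a)" unfolding K_act_def by blast
  qed
qed

lemma conic_pullback_conic_coeffs:
  assumes a: "a \<in> conic_coeffs" and B: "invertible B"
  shows "conic_pullback B a \<in> conic_coeffs"
proof -
  have l: "a$1$0 = 0" "a$2$0 = 0" "a$2$1 = 0" using a by (auto simp: conic_coeffs_iff)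
  obtain A where A: "B ** A = mat 1" "A ** B = mat 1" using matrix_inv_cancel[OF B] .
  have "conic_pullback B a \<noteq> 0"
  proof
    \<comment> \<open>Otherwise every symmetric matrix would satisfy the pulled-back equation;
      transporting back by \<open>B\<close>, also that of \<open>a\<close>, forcing
      \<open>a = 0\<close>.\<close>
    assume "conic_pullback B a = 0"
    then have "hyperplane_of (conic_pullback B a) = sym_mats" by (auto simp: mem_hyperplane_of)
    then have "K_act A (hyperplane_of a) = sym_mats" using K_act_hyperplane_of[OF A(2,1) l] by simp
    then have "K_act B (K_act A (hyperplane_of a)) = K_act B sym_mats" by simp
    then have "hyperplane_of a = K_act B sym_mats" by (simp add: K_act_mult A)
    moreover have "Z \<in> K_act B sym_mats" if "Z \<in> sym_mats" for Z
    proof -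
      have "Z \<in> K_act B (K_act A sym_mats)" using that by (simp add: K_act_mult A)
      moreover have "K_act A sym_mats \<subseteq> sym_mats" using congruence_sym_mats by (auto simp: K_act_def)
      ultimately show ?thesis by (auto simp: K_act_def)
    qed
    ultimately have "smat u v w x y z \<in> hyperplane_of a" for u v w x y z by simp
    from this[of 1 0 0 0 0 0] this[of 0 1 0 0 0 0] this[of 0 0 1 0 0 0]
      this[of 0 0 0 1 0 0] this[of 0 0 0 0 1 0] this[of 0 0 0 0 0 1]
    have "a = 0" using l by (simp add: vec_eq_iff all3 mem_hyperplane_of)
    then show False using a by (simp add: conic_coeffs_iff)
  qed
  then show ?thesis by (simp add: conic_coeffs_iff)
qed

text \<open>Treats \<open>H1\<close>, \<open>H3\<close> and the auxiliary class of geometric line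
  pairs uniformly.\<close>

definition hyperplanes_with :: "('a::field^3^3 \<Rightarrow> bool) \<Rightarrow> ('a^3^3) set set" where
  "hyperplanes_with P = {hyperplane_of a | a. a \<in> conic_coeffs \<and> P a}"

text \<open>\<open>K_act A\<close> maps one set onto the other with inverse \<open>K_act B\<close>;
  invariance of \<open>P\<close> under all invertible substitutions serves both maps.\<close>

lemma card_hyperplanes_K_act:
  assumes P: "\<And>a B. a \<in> conic_coeffs \<Longrightarrow> invertible B \<Longrightarrow> P a \<Longrightarrow> P (conic_pullback B a)"
    and A: "invertible A"
  shows "card {H \<in> hyperplanes_with P. K_act A W \<subseteq> H} = card {H \<in> hyperplanes_with P. W \<subseteq> H}"
proof -
  obtain B where B: "A ** B = mat 1" "B ** A = mat 1" "invertible B" using matrix_inv_cancel[OF A] .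
  have step: "K_act C H \<in> hyperplanes_with P"
    if CD: "C ** D = mat 1" "D ** C = mat 1" "invertible D" and H: "H \<in> hyperplanes_with P" for C D H
  proof -
    obtain a where a: "a \<in> conic_coeffs" "P a" "H = hyperplane_of a"
      using H by (auto simp: hyperplanes_with_def)
    have "K_act C H = hyperplane_of (conic_pullback D a)"
      unfolding a(3) using a(1) CD by (intro K_act_hyperplane_of) (auto simp: conic_coeffs_iff)
    then show ?thesis
      using P[OF a(1) CD(3) a(2)] conic_pullback_conic_coeffs[OF a(1) CD(3)] by (auto simp: hyperplanes_with_def)
  qed
  have mono: "U \<subseteq> V \<Longrightarrow> K_act C U \<subseteq> K_act C V" for C U and V :: "('a^3^3) set"
    by (auto simp: K_act_def)
  have AB: "K_act A (K_act B U) = U" and BA: "K_act B (K_act A U) = U" for U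
    by (simp_all add: K_act_mult B)
  have "bij_betw (K_act A) {H \<in> hyperplanes_with P. W \<subseteq> H} {H \<in> hyperplanes_with P. K_act A W \<subseteq> H}"
  proof (rule bij_betw_byWitness[where f' = "K_act B"])
    show "K_act A ` {H \<in> hyperplanes_with P. W \<subseteq> H} \<subseteq> {H \<in> hyperplanes_with P. K_act A W \<subseteq> H}"
      using step[OF B(1,2,3)] mono by blast
    show "K_act B ` {H \<in> hyperplanes_with P. K_act A W \<subseteq> H} \<subseteq> {H \<in> hyperplanes_with P. W \<subseteq> H}"
      using step[OF B(2,1) A] mono[of "K_act A W" _ B] by (auto simp: BA)
  qed (simp_all add: AB BA)
  then show ?thesis by (simp add: bij_betw_same_card)
qed

section \<open>Invariance of the conic types under change of coordinates\<close>

lemma ac_mat_conic_pullback: "ac_mat (conic_pullback B a) = conic_pullback (ac_mat B) (ac_mat a)"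
  by (simp add: vec_eq_iff all3 ac_mat_def conic_pullback_def Let_def matrix_matrix_mult_def
      transpose_def sum_UNIV3)

lemma qform_ac_conic_pullback:
  assumes "a \<in> conic_coeffs"
  shows "qform (ac_mat (conic_pullback B a)) x = qform (ac_mat a) (ac_mat B *v x)"
  unfolding ac_mat_conic_pullback
  by (rule qform_conic_pullback) (use assms in \<open>simp_all add: conic_coeffs_iff ac_mat_def\<close>)

lemma lform_mult_vec: "lform l (B *v x) = lform (transpose B *v l) x"
  by (simp add: lform_expand matrix_vector_mult_def transpose_def sum_UNIV3 algebra_simps)

lemma ac_vec_mult_vec: "ac_vec (B *v l) = ac_mat B *v ac_vec l"
  by (simp add: vec_eq_iff ac_vec_def ac_mat_def matrix_vector_mult_def to_ac_sum)

lemma transpose_ac_mat: "transpose (ac_mat B) = ac_mat (transpose B)"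
  by (simp add: vec_eq_iff ac_mat_def transpose_def)

lemma ac_mat_mult: "ac_mat (A ** B) = ac_mat A ** ac_mat B"
  by (simp add: vec_eq_iff ac_mat_def matrix_matrix_mult_def to_ac_sum)

lemma ac_mat_1: "ac_mat (mat 1) = mat 1"
  by (simp add: vec_eq_iff ac_mat_def mat_def)

lemma invertible_ac_mat: "invertible B \<Longrightarrow> invertible (ac_mat B)"
  unfolding invertible_def by (metis ac_mat_1 ac_mat_mult)

lemma invertible_mult_vec_eq_0_iff:
  fixes B :: "'a::field^3^3"
  assumes "invertible B" shows "B *v x = 0 \<longleftrightarrow> x = 0"
proof -
  obtain C where "C ** B = mat 1" using matrix_inv_cancel[OF assms] by blast
  then have "x = C *v (B *v x)" by (simp add: matrix_vector_mul_assoc)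
  then show ?thesis by (metis matrix_vector_mult_0_right)
qed

lemma invertible_transpose:
  assumes "invertible (B :: 'a::field^3^3)" shows "invertible (transpose B)"
  using assms by (simp add: invertible_det_nz)

lemma double_line_conic_pullback:
  assumes a: "a \<in> conic_coeffs" and B: "invertible B" and d: "double_line a"
  shows "double_line (conic_pullback B a)"
proof -
  obtain c l where cl: "c \<noteq> 0" "l \<noteq> 0" "\<And>x. qform (ac_mat a) x = to_ac c * (lform (ac_vec l) x)\<^sup>2"
    using d by (auto simp: double_line_def)
  have "qform (ac_mat (conic_pullback B a)) x = to_ac c * (lform (ac_vec (transpose B *v l)) x)\<^sup>2" for x
    unfolding qform_ac_conic_pullback[OF a] cl(3) lform_mult_vec ac_vec_mult_vec transpose_ac_mat ..
  moreover have "transpose B *v l \<noteq> 0"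
    using invertible_mult_vec_eq_0_iff[OF invertible_transpose[OF B]] cl(2) by blast
  ultimately show ?thesis using cl(1) unfolding double_line_def by blast
qed

text \<open>The partial derivatives at \<open>x\<close> are the coefficients of the polar form with
  one argument \<open>x\<close>.\<close>

lemma qform_add:
  "qform a (x + y) = qform a x + qform a y + (\<Sum>k\<in>UNIV. qform_partial a k x * y $ k)"
  by (simp add: qform_expand qform_partial_def sum_UNIV3 atLeast3 algebra_simps)

text \<open>A coordinate-free form of singularity, which spares transforming partial derivatives
  under substitutions.\<close>

lemma nonsingular_conic_iff:
  "nonsingular_conic a \<longleftrightarrow> \<not> (\<exists>x. x \<noteq> 0 \<and> qform (ac_mat a) x = 0 \<and>
     (\<forall>y. qform (ac_mat a) (x + y) = qform (ac_mat a) x + qform (ac_mat a) y))"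
proof -
  have "(\<forall>k. qform_partial b k x = 0) \<longleftrightarrow> (\<forall>y. qform b (x + y) = qform b x + qform b y)"
    for b :: "'a alg_closure^3^3" and x
  proof
    assume r: "\<forall>y. qform b (x + y) = qform b x + qform b y"
    show "\<forall>k. qform_partial b k x = 0"
    proof
      fix k
      have "(\<Sum>j\<in>UNIV. qform_partial b j x * axis k 1 $ j) = 0"
        using r[rule_format, of "axis k 1"] qform_add[of b x "axis k 1"] by simp
      then show "qform_partial b k x = 0" by (simp add: axis_def if_distrib cong: if_cong)
    qed
  qed (simp add: qform_add)
  then show ?thesis unfolding nonsingular_conic_def by simp
qed

lemma nonsingular_conic_pullback:
  assumes a: "a \<in> conic_coeffs" and B: "invertible B" and n: "nonsingular_conic a"
  shows "nonsingular_conic (conic_pullback B a)"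
  unfolding nonsingular_conic_iff
proof
  let ?B = "ac_mat B" and ?q = "qform (ac_mat a)"
  assume "\<exists>x. x \<noteq> 0 \<and> qform (ac_mat (conic_pullback B a)) x = 0 \<and>
     (\<forall>y. qform (ac_mat (conic_pullback B a)) (x + y) =
        qform (ac_mat (conic_pullback B a)) x + qform (ac_mat (conic_pullback B a)) y)"
  then obtain x where x: "x \<noteq> 0" "?q (?B *v x) = 0"
    and y: "\<And>y. ?q (?B *v (x + y)) = ?q (?B *v x) + ?q (?B *v y)"
    by (auto simp: qform_ac_conic_pullback[OF a])
  have B': "invertible ?B" using B by (rule invertible_ac_mat)
  obtain C where C: "?B ** C = mat 1" using matrix_inv_cancel[OF B'] by blast
  have "?q (?B *v x + z) = ?q (?B *v x) + ?q z" for z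
  proof -
    \<comment> \<open>Every vector is an image under the substitution, so additivity transfers to
      all \<open>z\<close>.\<close>
    have "?B *v (C *v z) = z" by (simp add: matrix_vector_mul_assoc C)
    then show ?thesis using y[of "C *v z"] by (simp add: matrix_vector_right_distrib)
  qed
  moreover have "?B *v x \<noteq> 0" using invertible_mult_vec_eq_0_iff[OF B'] x(1) by blast
  ultimately show False using n x(2) unfolding nonsingular_conic_iff by blast
qed

text \<open>Covers real and imaginary line pairs at once, without having to follow the Frobenius
  conjugation through a change of coordinates.\<close>

definition geometric_line_pair :: "'a::field^3^3 \<Rightarrow> bool" where
  "geometric_line_pair a \<longleftrightarrow> (\<exists>l m. \<not> (\<forall>i j. l$i * m$j = l$j * m$i) \<and>
     (\<forall>x. qform (ac_mat a) x = lform l x * lform m x))"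

text \<open>The hypothesis says that the matrix of products \<open>l$i * m$j\<close> is symmetric,
  and congruence by \<open>D\<close> preserves symmetry.\<close>

lemma proportional_mult_vec:
  fixes l m :: "'a::field^3"
  assumes "\<forall>i j. l$i * m$j = l$j * m$i"
  shows "(D *v l) $ i * (D *v m) $ j = (D *v l) $ j * (D *v m) $ i"
proof -
  have "(D *v l) $ i * (D *v m) $ j = (\<Sum>k\<in>UNIV. \<Sum>h\<in>UNIV. D$i$k * D$j$h * (l$k * m$h))"
    by (simp add: matrix_vector_mult_def sum_product mult_ac)
  also have "\<dots> = (\<Sum>h\<in>UNIV. \<Sum>k\<in>UNIV. D$i$k * D$j$h * (l$h * m$k))"
    by (subst sum.swap) (intro sum.cong refl arg_cong2[of _ _ _ _ times] assms[rule_format])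
  also have "\<dots> = (D *v l) $ j * (D *v m) $ i"
    by (simp add: matrix_vector_mult_def sum_product mult_ac)
  finally show ?thesis .
qed

lemma geometric_line_pair_conic_pullback:
  assumes a: "a \<in> conic_coeffs" and B: "invertible B" and g: "geometric_line_pair a"
  shows "geometric_line_pair (conic_pullback B a)"
proof -
  let ?T = "transpose (ac_mat B)"
  obtain l m where lm: "\<not> (\<forall>i j. l$i * m$j = l$j * m$i)" "\<And>x. qform (ac_mat a) x = lform l x * lform m x"
    using g by (auto simp: geometric_line_pair_def)
  have "qform (ac_mat (conic_pullback B a)) x = lform (?T *v l) x * lform (?T *v m) x" for x
    by (simp add: qform_ac_conic_pullback[OF a] lm(2) lform_mult_vec)
  moreover have "\<not> (\<forall>i j. (?T *v l)$i * (?T *v m)$j = (?T *v l)$j * (?T *v m)$i)"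
  proof
    assume p: "\<forall>i j. (?T *v l)$i * (?T *v m)$j = (?T *v l)$j * (?T *v m)$i"
    obtain C where C: "C ** ?T = mat 1"
      using matrix_inv_cancel[OF invertible_transpose[OF invertible_ac_mat[OF B]]] by blast
    have "C *v (?T *v x) = x" for x by (simp only: matrix_vector_mul_assoc C matrix_vector_mul_lid)
    \<comment> \<open>Proportional images would be carried back by the inverse \<open>C\<close> to
      proportional \<open>l\<close> and \<open>m\<close>.\<close>
    then have "\<forall>i j. l$i * m$j = l$j * m$i" using proportional_mult_vec[OF p, of C] by metis
    then show False using lm(1) by blast
  qed
  ultimately show ?thesis unfolding geometric_line_pair_def by blast
qed

lemma proportional_imp_scale:
  fixes l m :: "'a::field^3"
  assumes "l \<noteq> 0" "\<forall>i j. l$i * m$j = l$j * m$i"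
  shows "\<exists>c. m = c *s l"
proof -
  obtain i where i: "l$i \<noteq> 0" using assms(1) by (auto simp: vec_eq_iff)
  have "m = (m$i / l$i) *s l"
    using assms(2) i by (simp add: vec_eq_iff field_simps)
  then show ?thesis by blast
qed

lemma real_line_pair_imp_geometric:
  assumes "real_line_pair a" shows "geometric_line_pair a"
proof -
  obtain l m where lm: "l \<noteq> 0" "\<nexists>c. m = c *s l"
    "\<forall>x. qform (ac_mat a) x = lform (ac_vec l) x * lform (ac_vec m) x"
    using assms by (auto simp: real_line_pair_def)
  have "\<not> (\<forall>i j. l$i * m$j = l$j * m$i)" using proportional_imp_scale lm(1,2) by blast
  \<comment> \<open>The embedding into the closure is injective, so a nonzero 2 x 2 minor stays
    nonzero.\<close>
  then have "\<not> (\<forall>i j. ac_vec l$i * ac_vec m$j = ac_vec l$j * ac_vec m$i)"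
    by (simp add: ac_vec_def to_ac_mult[symmetric] del: to_ac_mult)
  then show ?thesis using lm(3) unfolding geometric_line_pair_def by blast
qed

lemma lform_scale: "lform (c *s l) x = c * lform l x"
  by (simp add: lform_expand algebra_simps)

lemma imaginary_line_pair_imp_geometric:
  assumes "imaginary_line_pair a" shows "geometric_line_pair a"
proof -
  obtain c and l :: "'a alg_closure^3" where l: "c \<noteq> 0" "l \<noteq> 0" "\<nexists>d. conj_vec l = d *s l"
    "\<forall>x. qform (ac_mat a) x = to_ac c * (lform l x * lform (conj_vec l) x)"
    using assms by (auto simp: imaginary_line_pair_def)
  \<comment> \<open>The scalar is absorbed into one of the two lines.\<close>
  let ?l = "to_ac c *s l"
  have "\<not> (\<forall>i j. l$i * conj_vec l$j = l$j * conj_vec l$i)"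
    using proportional_imp_scale l(2,3) by blast
  then have "\<not> (\<forall>i j. ?l$i * conj_vec l$j = ?l$j * conj_vec l$i)"
    using l(1) by simp
  moreover have "\<forall>x. qform (ac_mat a) x = lform ?l x * lform (conj_vec l) x"
    using l(4) by (simp add: lform_scale mult.assoc)
  ultimately show ?thesis unfolding geometric_line_pair_def by blast
qed

text \<open>The conics \<open>s X\<^sub>0\<^sup>2 + t X\<^sub>1\<^sup>2 + u (X\<^sub>0X\<^sub>1 + X\<^sub>2\<^sup>2)\<close> whose hyperplanes contain
  the representative plane.\<close>

definition net_conic :: "'a::field \<Rightarrow> 'a \<Rightarrow> 'a \<Rightarrow> 'a^3^3" where
  "net_conic s t u = (\<chi> i j. if i = 0 \<and> j = 0 then s else if i = 1 \<and> j = 1 then t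
     else if i = 0 \<and> j = 1 \<or> i = 2 \<and> j = 2 then u else 0)"

lemma net_conic_nth [simp]:
  "net_conic s t u $ 0 $ 0 = s" "net_conic s t u $ 1 $ 1 = t" "net_conic s t u $ 0 $ 1 = u"
  "net_conic s t u $ 2 $ 2 = u"
  "net_conic s t u $ 0 $ 2 = 0" "net_conic s t u $ 1 $ 2 = 0"
  "net_conic s t u $ 1 $ 0 = 0" "net_conic s t u $ 2 $ 0 = 0" "net_conic s t u $ 2 $ 1 = 0"
  by (simp_all add: net_conic_def)

lemma net_conic_eq_iff: "net_conic s t u = net_conic s' t' u' \<longleftrightarrow> s = s' \<and> t = t' \<and> u = u'"
  by (metis net_conic_nth(1,2,3))

lemma net_conic_zero: "net_conic 0 0 0 = 0"
  by (simp add: vec_eq_iff all3)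

lemma mscale_net_conic: "mscale c (net_conic s t u) = net_conic (c * s) (c * t) (c * u)"
  by (simp add: vec_eq_iff all3 mscale_def)

lemma ac_mat_net_conic: "ac_mat (net_conic s t u) = net_conic (to_ac s) (to_ac t) (to_ac u)"
  by (simp add: vec_eq_iff all3 ac_mat_def)

lemma net_conic_coeffs: "net_conic s t u \<in> conic_coeffs \<longleftrightarrow> (s, t, u) \<noteq> (0, 0, 0)"
  using net_conic_eq_iff[of s t u 0 0 0] by (simp add: conic_coeffs_iff net_conic_zero)

section \<open>Hyperplanes through the representative plane\<close>

lemma sigma16_plane_subset_hyperplane_of_iff:
  fixes a :: "'a::field^3^3"
  assumes char2: "(2::'a) = 0" and a: "a \<in> conic_coeffs"
  shows "sigma16_plane \<subseteq> hyperplane_of a \<longleftrightarrow> (\<exists>s t u. a = net_conic s t u)"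
proof
  have neg: "- x = x" for x :: 'a
    using char2 by (metis add.inverse_unique mult_2 mult_zero_left)
  assume "sigma16_plane \<subseteq> hyperplane_of a"
  then have "smat 0 0 z y x z \<in> hyperplane_of a" for x y z by (auto simp: sigma16_plane_def)
  \<comment> \<open>Three generators of the plane give three linear conditions; in characteristic 2
    the first one says that the coefficients at (0, 1) and (2, 2) agree.\<close>
  from this[of 0 0 1] this[of 0 1 0] this[of 1 0 0]
  have "a$0$1 + a$2$2 = 0" "a$1$2 = 0" "a$0$2 = 0" by (simp_all add: mem_hyperplane_of)
  moreover from this have "a$0$1 = a$2$2" using neg by (metis add_eq_0_iff2)
  ultimately have "a = net_conic (a$0$0) (a$1$1) (a$2$2)"
    using a by (simp add: conic_coeffs_iff vec_eq_iff all3)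
  then show "\<exists>s t u. a = net_conic s t u" by blast
next
  assume "\<exists>s t u. a = net_conic s t u"
  then obtain s t u where "a = net_conic s t u" by blast
  moreover have "u * z + u * z = 0" for z
    using char2 by (metis mult_2 mult_zero_left)
  ultimately show "sigma16_plane \<subseteq> hyperplane_of a" by (auto simp: sigma16_plane_def mem_hyperplane_of)
qed

lemma char2_alg_closure: "(2::'a::field) = 0 \<Longrightarrow> (2::'a alg_closure) = 0"
  by (metis to_ac_0 to_ac_numeral)

text \<open>The first conclusion settles double lines, the second excludes pairs of distinct lines,
  real or imaginary. The point is that \<open>u\<close> is the coefficient of both X_0 X_1 and
  X_2^2, so that u^2 becomes twice a product.\<close>

lemma net_conic_product:
  fixes l m :: "'a::field^3"
  assumes char2: "(2::'a) = 0" and eq: "\<And>x. qform (net_conic s t u) x = lform l x * lform m x"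
  shows "u = 0" "\<forall>i j. l$i * m$j = l$j * m$i"
proof -
  have neg: "x = y" if "x + y = 0" for x y :: 'a
    using that char2 by (metis add.inverse_unique add_eq_0_iff mult_2 mult_zero_left)
  note ev = eq[unfolded qform_expand lform_expand]
  \<comment> \<open>Values at unit vectors give the square coefficients; values at sums of two of
    them give the mixed ones.\<close>
  have d: "l$0 * m$0 = s" "l$1 * m$1 = t" "l$2 * m$2 = u"
    using ev[of "axis 0 1"] ev[of "axis 1 1"] ev[of "axis 2 1"] by (simp_all add: axis_def)
  have "(l$0 + l$1) * (m$0 + m$1) = s + u + t" "(l$0 + l$2) * (m$0 + m$2) = s + u"
    "(l$1 + l$2) * (m$1 + m$2) = t + u"
    using ev[of "axis 0 1 + axis 1 1"] ev[of "axis 0 1 + axis 2 1"] ev[of "axis 1 1 + axis 2 1"]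
    by (simp_all add: axis_def)
  then have e: "l$0 * m$1 + l$1 * m$0 = u" "l$0 * m$2 + l$2 * m$0 = 0" "l$1 * m$2 + l$2 * m$1 = 0"
    using d by (simp_all add: algebra_simps)
  have e': "l$0 * m$2 = l$2 * m$0" "l$1 * m$2 = l$2 * m$1" using e neg by blast+
  have "u * u = (l$0 * m$1 + l$1 * m$0) * (l$2 * m$2)" using e d by simp
  also have "\<dots> = (l$0 * m$2) * (l$2 * m$1) + (l$1 * m$2) * (l$2 * m$0)" by (simp add: algebra_simps)
  also have "\<dots> = 2 * ((l$2 * m$0) * (l$2 * m$1))" by (simp add: e' algebra_simps)
  finally show u: "u = 0" using char2 by simp
  have "l$0 * m$1 = l$1 * m$0" using e(1) u neg by blast
  then show "\<forall>i j. l$i * m$j = l$j * m$i" using e' by (simp add: all3)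
qed

lemma not_geometric_line_pair_net_conic:
  assumes "(2::'a::field) = 0" shows "\<not> geometric_line_pair (net_conic s t (u::'a))"
  unfolding geometric_line_pair_def ac_mat_net_conic
  using net_conic_product(2)[OF char2_alg_closure[OF assms]] by blast

lemma double_line_net_conic_iff:
  fixes s t u :: "'a::{field,finite}"
  assumes char2: "(2::'a) = 0" and "net_conic s t u \<in> conic_coeffs"
  shows "double_line (net_conic s t u) \<longleftrightarrow> u = 0"
proof
  assume "double_line (net_conic s t u)"
  then obtain c l where "\<forall>x. qform (ac_mat (net_conic s t u)) x = to_ac c * (lform (ac_vec l) x)\<^sup>2"
    by (auto simp: double_line_def)
  \<comment> \<open>The constant joins one factor, giving a product of two linear forms.\<close>
  then have "qform (net_conic (to_ac s) (to_ac t) (to_ac u)) x =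
      lform (to_ac c *s ac_vec l) x * lform (ac_vec l) x" for x
    by (simp add: ac_mat_net_conic lform_scale power2_eq_square mult.assoc)
  from net_conic_product(1)[OF char2_alg_closure[OF char2] this] show "u = 0" by simp
next
  assume u: "u = 0"
  obtain \<alpha> where \<alpha>: "\<alpha>\<^sup>2 = s" using char2_sqrt[OF char2] .
  obtain \<beta> where \<beta>: "\<beta>\<^sup>2 = t" using char2_sqrt[OF char2] .
  \<comment> \<open>In characteristic 2 the sum of the squares of \<open>\<alpha> X_0\<close> and
    \<open>\<beta> X_1\<close> is the square of their sum.\<close>
  define l :: "'a^3" where "l = (\<chi> i. if i = 0 then \<alpha> else if i = 1 then \<beta> else 0)"
  have l: "l$0 = \<alpha>" "l$1 = \<beta>" "l$2 = 0" by (simp_all add: l_def)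
  have "l \<noteq> 0" using assms(2) u \<alpha> \<beta> l by (auto simp: net_conic_coeffs)
  moreover have "qform (ac_mat (net_conic s t u)) x = to_ac 1 * (lform (ac_vec l) x)\<^sup>2" for x
    using char2_alg_closure[OF char2]
    by (simp add: ac_mat_net_conic qform_expand lform_expand ac_vec_def l u \<alpha>[symmetric] \<beta>[symmetric]
        power2_sum power_mult_distrib) (simp add: power2_eq_square algebra_simps)
  ultimately show "double_line (net_conic s t u)" unfolding double_line_def by (metis zero_neq_one)
qed

text \<open>The derivatives are u X_1, u X_0 and 0. For nonzero \<open>u\<close> they vanish only at
  multiples of (0, 0, 1), the nucleus of the conic, where the form is u X_2^2; for u = 0 that point
  is singular.\<close>

lemma nonsingular_conic_net_conic_iff:
  fixes s t u :: "'a::field"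
  assumes char2: "(2::'a) = 0"
  shows "nonsingular_conic (net_conic s t u) \<longleftrightarrow> u \<noteq> 0"
proof
  have dbl: "x + x = 0" for x :: "'a alg_closure"
    using char2_alg_closure[OF char2] by (metis mult_2 mult_zero_left)
  have part: "qform_partial (net_conic s t u) 0 x = u * x$1" "qform_partial (net_conic s t u) 1 x = u * x$0"
    "qform_partial (net_conic s t u) 2 x = 0" for s t u and x :: "'a alg_closure^3"
    by (simp_all add: qform_partial_def sum_UNIV3 atLeast3 dbl distrib_left[symmetric])
  {
    assume "nonsingular_conic (net_conic s t u)"
    moreover have "axis 2 1 \<noteq> (0 :: 'a alg_closure^3)" by (simp add: axis_eq_0_iff)
    moreover have "qform (ac_mat (net_conic s t 0)) (axis 2 1) = 0"
      by (simp add: ac_mat_net_conic qform_expand axis_def)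
    moreover have "\<forall>k. qform_partial (ac_mat (net_conic s t 0)) k (axis 2 1) = 0"
      by (simp add: all3 ac_mat_net_conic part)
    ultimately show "u \<noteq> 0" unfolding nonsingular_conic_def by blast
  next
    assume u: "u \<noteq> 0"
    show "nonsingular_conic (net_conic s t u)"
      unfolding nonsingular_conic_def
    proof
      assume "\<exists>x. x \<noteq> 0 \<and> qform (ac_mat (net_conic s t u)) x = 0 \<and>
        (\<forall>k. qform_partial (ac_mat (net_conic s t u)) k x = 0)"
      then obtain x where x: "x \<noteq> 0" "qform (ac_mat (net_conic s t u)) x = 0"
        "\<forall>k. qform_partial (ac_mat (net_conic s t u)) k x = 0" by blast
      then have "x$0 = 0" "x$1 = 0" using u by (auto simp: all3 ac_mat_net_conic part)
      moreover from this have "x$2 = 0" using x(2) u by (simp add: ac_mat_net_conic qform_expand)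
      ultimately show False using x(1) by (simp add: vec_eq_iff all3)
    qed
  }
qed

lemma hyperplanes_with_containing_sigma16_plane:
  fixes P :: "'a::field^3^3 \<Rightarrow> bool"
  assumes "(2::'a) = 0"
  shows "{H \<in> hyperplanes_with P. sigma16_plane \<subseteq> H} =
    hyperplane_of ` {net_conic s t u | s t u. net_conic s t u \<in> conic_coeffs \<and> P (net_conic s t u)}"
  using sigma16_plane_subset_hyperplane_of_iff[OF assms] unfolding hyperplanes_with_def by blast

text \<open>There are q^2 - 1 nonzero coefficient triples with u = 0, and q - 1 of them define each
  hyperplane.\<close>

lemma card_double_lines_sigma16_plane:
  assumes char2: "(2::'a::{field,finite}) = 0"
  shows "card {H \<in> hyperplanes_with double_line. (sigma16_plane :: ('a^3^3) set) \<subseteq> H} = CARD('a) + 1"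
proof -
  let ?q = "CARD('a)"
  let ?S = "range (\<lambda>(s, t :: 'a). net_conic s t 0) - {0}"
  have S: "{net_conic s t u | s t u :: 'a. net_conic s t u \<in> conic_coeffs \<and>
      double_line (net_conic s t u)} = ?S"
    using double_line_net_conic_iff[OF char2]
    by (auto simp: net_conic_coeffs net_conic_zero[symmetric] net_conic_eq_iff image_iff)
  have "card (range (\<lambda>(s, t :: 'a). net_conic s t 0)) = ?q * ?q"
    by (subst card_image) (auto simp: inj_def net_conic_eq_iff)
  moreover have "0 \<in> range (\<lambda>(s, t :: 'a). net_conic s t 0)"
    by (auto simp: net_conic_zero[symmetric] image_iff net_conic_eq_iff)
  ultimately have "card ?S = ?q * ?q - 1" by (simp add: card_Diff_singleton)
  moreover have "card ?S = (?q - 1) * card (hyperplane_of ` ?S)"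
  proof (rule card_projective_image)
    have cc: "a \<in> conic_coeffs" if "a \<in> ?S" for a using that unfolding S[symmetric] by blast
    show "hyperplane_of a = hyperplane_of b \<longleftrightarrow> (\<exists>c. c \<noteq> 0 \<and> b = mscale c a)"
      if "a \<in> ?S" "b \<in> ?S" for a b using that cc by (intro hyperplane_of_eq_iff)
    show "mscale c a \<in> ?S" if "a \<in> ?S" "c \<noteq> 0" for a c
    proof -
      obtain s t where "a = net_conic s t 0" "a \<noteq> 0" using \<open>a \<in> ?S\<close> by auto
      moreover from this have "mscale c a \<noteq> 0" using \<open>c \<noteq> 0\<close> by simp
      ultimately show ?thesis
        by (intro DiffI image_eqI[of _ _ "(c * s, c * t)"]) (auto simp: mscale_net_conic)
    qed
  qed simp
  moreover have "?q * ?q - 1 = (?q - 1) * (?q + 1)"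
    by (simp add: algebra_simps)
  ultimately have "(?q - 1) * card (hyperplane_of ` ?S) = (?q - 1) * (?q + 1)" by presburger
  then have "card (hyperplane_of ` ?S) = ?q + 1"
    unfolding mult_cancel1 using card_field_ge_2[where 'a = 'a] by linarith
  then show ?thesis by (simp only: hyperplanes_with_containing_sigma16_plane[OF char2] S)
qed

text \<open>There are q^2 (q - 1) triples with nonzero \<open>u\<close>, again q - 1 for each
  hyperplane.\<close>

lemma card_nonsingular_sigma16_plane:
  assumes char2: "(2::'a::{field,finite}) = 0"
  shows "card {H \<in> hyperplanes_with nonsingular_conic. (sigma16_plane :: ('a^3^3) set) \<subseteq> H} = CARD('a)\<^sup>2"
proof -
  let ?q = "CARD('a)"
  let ?S = "(\<lambda>(s, t, u :: 'a). net_conic s t u) ` (UNIV \<times> UNIV \<times> (UNIV - {0}))"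
  have S: "{net_conic s t u | s t u :: 'a. net_conic s t u \<in> conic_coeffs \<and>
      nonsingular_conic (net_conic s t u)} = ?S"
    using nonsingular_conic_net_conic_iff[OF char2]
    by (auto simp: net_conic_coeffs net_conic_eq_iff image_iff)
  have "card ?S = card ((UNIV :: 'a set) \<times> (UNIV :: 'a set) \<times> (UNIV - {0 :: 'a}))"
    by (rule card_image) (auto simp: inj_on_def net_conic_eq_iff)
  then have "card ?S = (?q - 1) * ?q\<^sup>2"
    by (simp add: card_cartesian_product card_Diff_singleton power2_eq_square)
  moreover have "card ?S = (?q - 1) * card (hyperplane_of ` ?S)"
  proof (rule card_projective_image)
    have cc: "a \<in> conic_coeffs" if "a \<in> ?S" for a using that unfolding S[symmetric] by blast
    show "hyperplane_of a = hyperplane_of b \<longleftrightarrow> (\<exists>c. c \<noteq> 0 \<and> b = mscale c a)"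
      if "a \<in> ?S" "b \<in> ?S" for a b using that cc by (intro hyperplane_of_eq_iff)
    show "mscale c a \<in> ?S" if "a \<in> ?S" "c \<noteq> 0" for a c
    proof -
      obtain s t u where "a = net_conic s t u" "u \<noteq> 0" using \<open>a \<in> ?S\<close> by auto
      then show ?thesis using \<open>c \<noteq> 0\<close>
        by (intro image_eqI[of _ _ "(c * s, c * t, c * u)"]) (auto simp: mscale_net_conic)
    qed
    show "0 \<notin> ?S" by (auto simp: net_conic_zero[symmetric] net_conic_eq_iff)
  qed
  ultimately have "(?q - 1) * card (hyperplane_of ` ?S) = (?q - 1) * ?q\<^sup>2" by presburger
  then have "card (hyperplane_of ` ?S) = ?q\<^sup>2"
    unfolding mult_cancel1 using card_field_ge_2[where 'a = 'a] by linarith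
  then show ?thesis by (simp only: hyperplanes_with_containing_sigma16_plane[OF char2] S)
qed

lemma no_geometric_line_pairs_sigma16_plane:
  assumes char2: "(2::'a::{field,finite}) = 0"
  shows "card {H \<in> hyperplanes_with geometric_line_pair. (sigma16_plane :: ('a^3^3) set) \<subseteq> H} = 0"
  unfolding hyperplanes_with_containing_sigma16_plane[OF char2]
  using not_geometric_line_pair_net_conic[OF char2] by simp

lemma hyperplane_orbit_distribution_K_orbit_sigma16_plane:
  fixes W :: "('a::{field,finite}^3^3) set"
  assumes char2: "(2::'a) = 0" and W: "W \<in> K_orbit sigma16_plane"
  shows "hyperplane_orbit_distribution W = [CARD('a) + 1, 0, 0, (CARD('a))\<^sup>2]"
proof -
  obtain A where A: "invertible A" "W = K_act A sigma16_plane" using W by (auto simp: K_orbit_def)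
  have "card {H \<in> hyperplanes_with double_line. W \<subseteq> H} = CARD('a) + 1"
    unfolding A(2) card_double_lines_sigma16_plane[OF char2, symmetric]
    by (rule card_hyperplanes_K_act[OF _ A(1)]) (rule double_line_conic_pullback)
  moreover have "card {H \<in> hyperplanes_with nonsingular_conic. W \<subseteq> H} = (CARD('a))\<^sup>2"
    unfolding A(2) card_nonsingular_sigma16_plane[OF char2, symmetric]
    by (rule card_hyperplanes_K_act[OF _ A(1)]) (rule nonsingular_conic_pullback)
  moreover have "card {H \<in> hyperplanes_with geometric_line_pair. W \<subseteq> H} = 0"
    unfolding A(2) no_geometric_line_pairs_sigma16_plane[OF char2, symmetric]
    by (rule card_hyperplanes_K_act[OF _ A(1)]) (rule geometric_line_pair_conic_pullback)
  then have "{H \<in> hyperplanes_with geometric_line_pair. W \<subseteq> H} = {}" by simp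
  \<comment> \<open>Real and imaginary pairs are both geometric line pairs, so one empty set
    disposes of both entries.\<close>
  then have "{H \<in> H2r. W \<subseteq> H} = {}" "{H \<in> H2i. W \<subseteq> H} = {}"
    using real_line_pair_imp_geometric imaginary_line_pair_imp_geometric
    unfolding H2r_def H2i_def hyperplanes_with_def by blast+
  moreover have "H1 = hyperplanes_with (double_line :: 'a^3^3 \<Rightarrow> bool)"
    "H3 = hyperplanes_with (nonsingular_conic :: 'a^3^3 \<Rightarrow> bool)"
    by (simp_all add: H1_def H3_def hyperplanes_with_def)
  ultimately show ?thesis unfolding hyperplane_orbit_distribution_def by simp
qed

theorem theorem3p5:
  fixes q :: nat
  assumes "q = CARD('a::{field,finite})" and "even q" and "q \<ge> 4"
  shows "\<exists>\<Sigma>16 \<in> (plane_orbits :: ('a^3^3) set set set).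
      {W \<in> planes. point_orbit_distribution W = [0, q + 1, 0, q\<^sup>2]} = \<Sigma>16 \<and>
      (\<forall>W \<in> \<Sigma>16. hyperplane_orbit_distribution W = [q + 1, 0, 0, q\<^sup>2])"
proof -
  have char2: "(2::'a) = 0" using assms(1,2) even_card_imp_char2 by blast
  have "{W :: ('a^3^3) set. good_plane W} = {W \<in> planes. point_orbit_distribution W = [0, q + 1, 0, q\<^sup>2]}"
    unfolding assms(1) using good_plane_iff[OF char2] by blast
  then have "{W :: ('a^3^3) set. W \<in> planes \<and> point_orbit_distribution W = [0, q + 1, 0, q\<^sup>2]} =
      K_orbit sigma16_plane"
    using good_planes_eq_K_orbit[OF char2] by simp
  \<comment> \<open>Membership in \<open>plane_orbits\<close> requires the representative to be a
    plane, which \<open>good_plane_iff\<close> supplies.\<close>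
  moreover have "K_orbit (sigma16_plane :: ('a^3^3) set) \<in> plane_orbits"
    using good_plane_sigma16_plane[OF char2] good_plane_iff[OF char2] by (auto simp: plane_orbits_def)
  ultimately show ?thesis
    using hyperplane_orbit_distribution_K_orbit_sigma16_plane[OF char2] assms(1) by blast
qed

end
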